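(* Let $\alpha\in(0,1)$. Suppose $y=(y_1,\dots,y_n)^\top$ is generated from the logistic regression model with fixed design $\mathbf{X}\in\mathbb{R}^{n\times p}$ and true coefficient $\beta^*\in\mathbb{R}^p$, and let $(q^*,\xi^* )$ be a minimizer of the variational objective $\mathcal{L}(q,\xi)$ defined in the context, so that $q^*$ is the $\mathrm{N}_p\{\mu_\alpha(\xi^* ),\Sigma_\alpha(\xi^* )/\alpha\}$ density. Then there is a constant $D>0$ such that for any $\varepsilon\in(0,1)$, with probability at least $(1-\varepsilon)-\dfrac{1}{(D-1)^2\,n\,\varepsilon^2}$ under the true model, $$(1-\alpha)\int \mathrm{D}_\alpha(\beta,\beta^* )\,\phi_p\{\beta;\mu_\alpha(\xi^* ),\Sigma_\alpha(\xi^* )/\alpha\}\,d\beta\;\le\; D\alpha\,\varepsilon^2+\frac{p}{n}\log\Big\{\frac{L(\beta^*,\mathbf{X})}{\varepsilon^2}\Big\}+C_n(\beta^*,\mu_\beta,\Sigma_\beta)+\frac1n\log\Big(\frac1\varepsilon\Big),$$ where $C_n(\beta^*,\mu_\beta,\Sigma_\beta)=\frac{1}{2n}(\beta^*-\mu_\beta)^\top\Sigma_\beta^{-1}(\beta^*-\mu_\beta)$ and $L(\beta^*,\mathbf{X})=\max\{4\|\mathbf{X}\|_{2,\infty},\,8\|\mathbf{X}\|_{2,\infty}^2\|\beta^*\|_2\}$.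
   Context: Model: $\mathbf{X}$ is a fixed $n\times p$ real matrix with rows $\mathbf{x}_i^\top$. For $\beta\in\mathbb{R}^p$, $p(y\mid\beta,\mathbf{X})=\exp[y^\top\mathbf{X}\beta-\sum_{i=1}^n\log(1+e^{\mathbf{x}_i^\top\beta})]$ for $y\in\{0,1\}^n$, i.e. the $y_i$ are independent Bernoulli$(p_{i,\beta})$ with $p_{i,\beta}=1/\{1+\exp(-\mathbf{x}_i^\top\beta)\}$. The data are generated from $p(\cdot\mid\beta^*,\mathbf{X})$. The prior on $\beta$ is $\mathrm{N}_p(\mu_\beta,\Sigma_\beta)$ with $\Sigma_\beta$ positive definite. $\phi_p(x;\mu,\Sigma)$ denotes the $p$-dimensional Gaussian density at $x$ with mean $\mu$ and covariance $\Sigma$. $\|\mathbf{X}\|_{2,\infty}=\max_i\|\mathbf{x}_i\|_2$. For $t\in\mathbb{R}$: $A(t)=-\tanh(t/2)/(4t)$ (with $A(0)=-1/8$), $C(t)=t/2-\log\{1+\exp(t)\}+t\tanh(t/2)/4$. For $\xi\in\mathbb{R}^n$, $A(\xi)$ and $C(\xi)$ are applied elementwise, $\mathrm{diag}\{A(\xi)\}$ is the diagonal matrix with entries $A(\xi_i)$, and $\mathbf{1}_n$ is the all-ones vector. Define $$\Sigma_\alpha^{-1}(\xi)=\Sigma_\beta^{-1}/\alpha-2\mathbf{X}^\top\mathrm{diag}\{A(\xi)\}\mathbf{X},\qquad \mu_\alpha^\top(\xi)\Sigma_\alpha^{-1}(\xi)=(y-\tfrac12\mathbf{1}_n)^\top\mathbf{X}+\mu_\beta^\top\Sigma_\beta^{-1}/\alpha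 .$$ Variational objective: let $$\log p_\ell^\alpha(y,\beta\mid\mathbf{X},\xi)=\alpha\{(y-\tfrac12\mathbf{1}_n)^\top\mathbf{X}\beta+\beta^\top\mathbf{X}^\top\mathrm{diag}\{A(\xi)\}\mathbf{X}\beta+\mathbf{1}_n^\top C(\xi)\}+\log\phi_p(\beta;\mu_\beta,\Sigma_\beta),$$ and for a probability density $q$ on $\mathbb{R}^p$ and $\xi\in\mathbb{R}^n$, $$\mathcal{L}(q,\xi)=-\int\log\frac{p_\ell^\alpha(y,\beta\mid\mathbf{X},\xi)}{q(\beta)}\,q(\beta)\,d\beta ,$$ to be minimized over all densities $q$ on $\mathbb{R}^p$ and all $\xi\in\mathbb{R}^n$. $\alpha$-Rényi divergence (per observation): $\mathrm{D}_\alpha(\beta,\beta^* )=\frac{1}{n(\alpha-1)}\sum_{i=1}^n\log\big[p_{i,\beta}^\alpha p_{i,\beta^*}^{1-\alpha}+(1-p_{i,\beta})^\alpha(1-p_{i,\beta^*})^{1-\alpha}\big]$. *)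

theory Defs
  imports "HOL-Probability.Probability"
begin

text \<open>
  A design with \<open>n\<close> observations is given by its rows \<open>X i\<close>, \<open>i < n\<close>; the values \<open>X i\<close> for
  \<open>i \<ge> n\<close> are never used, and the same holds for vectors in \<open>\<real>\<^sup>n\<close>, which have type
  \<open>nat \<Rightarrow> real\<close>. The number of rows is not a type so that it can be quantified inside a formula.
  Responses have type \<open>nat \<Rightarrow> bool\<close>, with \<open>True\<close> for 1.
\<close>

definition success_prob :: "(nat \<Rightarrow> real ^ 'p) \<Rightarrow> real ^ 'p \<Rightarrow> nat \<Rightarrow> real" where
  "success_prob X \<beta> i = 1 / (1 + exp (- (X i \<bullet> \<beta>)))"

definition responses :: "nat \<Rightarrow> (nat \<Rightarrow> bool) set" where
  "responses n = PiE_dflt {..<n} False (\<lambda>_. UNIV)"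

definition logit_pmf :: "nat \<Rightarrow> (nat \<Rightarrow> real ^ 'p) \<Rightarrow> real ^ 'p \<Rightarrow> (nat \<Rightarrow> bool) pmf" where
  "logit_pmf n X \<beta> = Pi_pmf {..<n} False (\<lambda>i. bernoulli_pmf (success_prob X \<beta> i))"

lemma pmf_logit_pmf:
  assumes "y \<in> responses n"
  shows "pmf (logit_pmf n X \<beta>) y =
    exp ((\<Sum>i<n. of_bool (y i) * (X i \<bullet> \<beta>)) - (\<Sum>i<n. ln (1 + exp (X i \<bullet> \<beta>))))"
proof -
  have *: "pmf (bernoulli_pmf (success_prob X \<beta> i)) b =
      exp (of_bool b * (X i \<bullet> \<beta>) - ln (1 + exp (X i \<bullet> \<beta>)))" for i b
  proof -
    have pos: "1 + exp (X i \<bullet> \<beta>) > 0" by (simp add: add_pos_pos)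
    have eq: "success_prob X \<beta> i = exp (X i \<bullet> \<beta>) / (1 + exp (X i \<bullet> \<beta>))"
      unfolding success_prob_def exp_minus using pos
      by (simp add: field_simps)
    have "0 \<le> success_prob X \<beta> i" "success_prob X \<beta> i \<le> 1"
      unfolding eq using pos by (simp_all add: field_simps)
    thus ?thesis using pos
      by (cases b) (simp_all add: eq exp_diff exp_minus field_simps)
  qed
  have "pmf (logit_pmf n X \<beta>) y = (\<Prod>i<n. pmf (bernoulli_pmf (success_prob X \<beta> i)) (y i))"
    unfolding logit_pmf_def using assms
    by (intro pmf_Pi') (auto simp: responses_def PiE_dflt_def)
  also have "\<dots> = exp (\<Sum>i<n. of_bool (y i) * (X i \<bullet> \<beta>) - ln (1 + exp (X i \<bullet> \<beta>)))"
    unfolding * by (simp add: exp_sum)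
  finally show ?thesis by (simp add: sum_subtractf)
qed

definition pos_def :: "real ^ 'p ^ 'p \<Rightarrow> bool" where
  "pos_def S \<longleftrightarrow> transpose S = S \<and> (\<forall>v. v \<noteq> 0 \<longrightarrow> v \<bullet> (S *v v) > 0)"

definition gauss_density :: "real ^ 'p \<Rightarrow> real ^ 'p ^ 'p \<Rightarrow> real ^ 'p \<Rightarrow> real" where
  "gauss_density \<mu> S x =
     exp (- ((x - \<mu>) \<bullet> (matrix_inv S *v (x - \<mu>))) / 2) / sqrt ((2 * pi) ^ CARD('p) * det S)"

definition A_fun :: "real \<Rightarrow> real" where
  "A_fun t = (if t = 0 then - 1 / 8 else - tanh (t / 2) / (4 * t))"

definition C_fun :: "real \<Rightarrow> real" where
  "C_fun t = t / 2 - ln (1 + exp t) + t * tanh (t / 2) / 4"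

text \<open>The matrix \<open>X\<^sup>T diag(A(\<xi>)) X\<close> and the vector \<open>X\<^sup>T (y - 1/2)\<close>:\<close>

definition XtAX :: "nat \<Rightarrow> (nat \<Rightarrow> real ^ 'p) \<Rightarrow> (nat \<Rightarrow> real) \<Rightarrow> real ^ 'p ^ 'p" where
  "XtAX n X \<xi> = (\<chi> j k. \<Sum>i<n. X i $ j * A_fun (\<xi> i) * X i $ k)"

definition Xt_centred :: "nat \<Rightarrow> (nat \<Rightarrow> real ^ 'p) \<Rightarrow> (nat \<Rightarrow> bool) \<Rightarrow> real ^ 'p" where
  "Xt_centred n X y = (\<Sum>i<n. (of_bool (y i) - 1 / 2) *\<^sub>R X i)"

definition Sigma_post ::
  "nat \<Rightarrow> (nat \<Rightarrow> real ^ 'p) \<Rightarrow> real \<Rightarrow> real ^ 'p ^ 'p \<Rightarrow> (nat \<Rightarrow> real) \<Rightarrow> real ^ 'p ^ 'p" where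
  "Sigma_post n X \<alpha> S \<xi> = matrix_inv ((1 / \<alpha>) *\<^sub>R matrix_inv S - 2 *\<^sub>R XtAX n X \<xi>)"

definition mu_post ::
  "nat \<Rightarrow> (nat \<Rightarrow> real ^ 'p) \<Rightarrow> real \<Rightarrow> real ^ 'p \<Rightarrow> real ^ 'p ^ 'p \<Rightarrow> (nat \<Rightarrow> bool) \<Rightarrow>
   (nat \<Rightarrow> real) \<Rightarrow> real ^ 'p" where
  "mu_post n X \<alpha> \<mu> S y \<xi> =
     (Xt_centred n X y + (1 / \<alpha>) *\<^sub>R (\<mu> v* matrix_inv S)) v* Sigma_post n X \<alpha> S \<xi>"

definition log_p_tangent ::
  "nat \<Rightarrow> (nat \<Rightarrow> real ^ 'p) \<Rightarrow> real \<Rightarrow> real ^ 'p \<Rightarrow> real ^ 'p ^ 'p \<Rightarrow> (nat \<Rightarrow> bool) \<Rightarrow>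
   (nat \<Rightarrow> real) \<Rightarrow> real ^ 'p \<Rightarrow> real" where
  "log_p_tangent n X \<alpha> \<mu> S y \<xi> \<beta> =
     \<alpha> * (Xt_centred n X y \<bullet> \<beta> + \<beta> \<bullet> (XtAX n X \<xi> *v \<beta>) + (\<Sum>i<n. C_fun (\<xi> i)))
     + ln (gauss_density \<mu> S \<beta>)"

definition prob_density :: "(real ^ 'p \<Rightarrow> real) \<Rightarrow> bool" where
  "prob_density q \<longleftrightarrow>
     q \<in> borel_measurable borel \<and> (\<forall>x. 0 \<le> q x) \<and> (\<integral>\<^sup>+x. ennreal (q x) \<partial>lborel) = 1"

text \<open>
  Bochner integrals are 0 for non-integrable functions, which would give a spurious objective value
  0 to densities whose true value is \<open>\<infinity>\<close>. So the integral in the objective is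
  taken in the extended reals, as the difference of the integrals of the positive and of the
  negative part (\<open>ennreal\<close> truncates negative numbers to 0). When the prior covariance is positive
  definite, the positive part below has a finite integral for every density \<open>q\<close>, as
  \<open>q ln (p / q) \<le> p / e\<close> and \<open>p\<close> is integrable; thus \<open>\<infinity> - \<infinity>\<close> does not occur. Points with
  \<open>q \<beta> = 0\<close> contribute 0.
\<close>

definition var_objective ::
  "nat \<Rightarrow> (nat \<Rightarrow> real ^ 'p) \<Rightarrow> real \<Rightarrow> real ^ 'p \<Rightarrow> real ^ 'p ^ 'p \<Rightarrow> (nat \<Rightarrow> bool) \<Rightarrow>
   (real ^ 'p \<Rightarrow> real) \<Rightarrow> (nat \<Rightarrow> real) \<Rightarrow> ereal" where
  "var_objective n X \<alpha> \<mu> S y q \<xi> =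
     (let f = (\<lambda>\<beta>. ln (exp (log_p_tangent n X \<alpha> \<mu> S y \<xi> \<beta>) / q \<beta>) * q \<beta>)
      in - (enn2ereal (\<integral>\<^sup>+\<beta>. ennreal (f \<beta>) \<partial>lborel) - enn2ereal (\<integral>\<^sup>+\<beta>. ennreal (- f \<beta>) \<partial>lborel)))"

definition is_minimizer ::
  "nat \<Rightarrow> (nat \<Rightarrow> real ^ 'p) \<Rightarrow> real \<Rightarrow> real ^ 'p \<Rightarrow> real ^ 'p ^ 'p \<Rightarrow> (nat \<Rightarrow> bool) \<Rightarrow>
   (real ^ 'p \<Rightarrow> real) \<Rightarrow> (nat \<Rightarrow> real) \<Rightarrow> bool" where
  "is_minimizer n X \<alpha> \<mu> S y q \<xi> \<longleftrightarrow> prob_density q \<and>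
     (\<forall>q' \<xi>'. prob_density q' \<longrightarrow>
        var_objective n X \<alpha> \<mu> S y q \<xi> \<le> var_objective n X \<alpha> \<mu> S y q' \<xi>')"

definition renyi_div ::
  "nat \<Rightarrow> (nat \<Rightarrow> real ^ 'p) \<Rightarrow> real \<Rightarrow> real ^ 'p \<Rightarrow> real ^ 'p \<Rightarrow> real" where
  "renyi_div n X \<alpha> \<beta> \<beta>' = 1 / (real n * (\<alpha> - 1)) *
     (\<Sum>i<n. ln (success_prob X \<beta> i powr \<alpha> * success_prob X \<beta>' i powr (1 - \<alpha>) +
                (1 - success_prob X \<beta> i) powr \<alpha> * (1 - success_prob X \<beta>' i) powr (1 - \<alpha>)))"

definition norm_2_inf :: "nat \<Rightarrow> (nat \<Rightarrow> real ^ 'p) \<Rightarrow> real" where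
  "norm_2_inf n X = Max ((\<lambda>i. norm (X i)) ` {..<n})"

definition L_const :: "nat \<Rightarrow> (nat \<Rightarrow> real ^ 'p) \<Rightarrow> real ^ 'p \<Rightarrow> real" where
  "L_const n X \<beta> = max (4 * norm_2_inf n X) (8 * (norm_2_inf n X)\<^sup>2 * norm \<beta>)"

definition C_const :: "nat \<Rightarrow> real ^ 'p \<Rightarrow> real ^ 'p \<Rightarrow> real ^ 'p ^ 'p \<Rightarrow> real" where
  "C_const n \<beta> \<mu> S = 1 / (2 * real n) * ((\<beta> - \<mu>) \<bullet> (matrix_inv S *v (\<beta> - \<mu>)))"

end

(* Write beta0 for the true coefficient and (q0, xi0) for the minimizer. Let h be n (1 - alpha)
   times the Renyi divergence from the truth, l the log-likelihood and l_xi <= l its Jaakkola-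
   Jordan tangent minorant. For fixed xi the objective is a Kullback-Leibler divergence minus ln
   Z(xi), where Z(xi) is the integral of exp(alpha l_xi) against the prior. So q0 is the normalised
   density exp(alpha l_xi0) prior / Z(xi0), which is Gaussian, and xi0 maximises Z. By Jensen, the
   mean of h under q0 is at most the logarithm of the integral of exp(h + alpha l) against the
   prior, minus ln Z(xi0). By Fubini the expectation over y of exp(h + alpha (l - l(beta0))),
   integrated against the prior, is 1, so Markov's inequality bounds that integral by exp(alpha
   l(beta0)) / eps with probability at least 1 - eps. Finally Z(xi0) >= Z(X beta0), and l_xi
   touches l at beta0 when xi = X beta0: completing the square there bounds Z(X beta0) exp(-alpha
   l(beta0)) below, without any randomness, by exp(-n C_n) times a power of n. *)
theory Submission
  imports Defs "HOL-Real_Asymp.Real_Asymp"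
begin

section \<open>Linear change of variables\<close>

text \<open>The chosen \<xi> depends on the data, so Markov's inequality cannot be applied to a
  quantity containing it. It leaves the numerator because the minorant is at most the log-likelihood
  for every \<xi>, and it leaves the normaliser because it is a maximiser; what Markov's inequality
  meets is \<open>renyi_integral\<close>, which is free of \<xi>. The constant \<open>D\<close> must
  be uniform in n, in the truth and in the prior mean. After multiplication by n, the lower bound on
  the evidence costs (p/2) ln n plus constants, while the right-hand side offers p ln
  (1/\<epsilon>^2) and D \<alpha> n \<epsilon>^2. With N = n \<epsilon>^2 it suffices that K + (p/2)
  ln N \<le> \<alpha> N, which is guaranteed above some threshold M. The choice (D - 1)^2 = 1/M
  turns the subtracted term 1/((D - 1)^2 n \<epsilon>^2) into M/N, which exceeds 1 below that
  threshold. The objective has extended real values, so the Gibbs inequality is proved for arbitrary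
  densities, including those of infinite divergence; its equality case determines q0 only almost
  everywhere.\<close>

lemma nn_integral_lborel_shear:
  fixes h :: "'a::euclidean_space \<Rightarrow> ennreal" and c :: "'a \<Rightarrow> real"
  assumes b: "b \<in> Basis"
    and [measurable]: "h \<in> borel_measurable borel" "c \<in> borel_measurable borel"
    and c: "\<And>x t. c (x + t *\<^sub>R b) = c x"
  shows "(\<integral>\<^sup>+x. h (x + c x *\<^sub>R b) \<partial>lborel) = (\<integral>\<^sup>+x. h x \<partial>lborel)"
proof -
  let ?E = "\<lambda>f. \<Sum>b'\<in>Basis. f b' *\<^sub>R (b'::'a)"
  let ?B = "Basis - {b} :: 'a set"
  interpret product_sigma_finite "\<lambda>_::'a. lborel :: real measure" ..
  have ins: "insert b ?B = Basis" using b by auto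
  have E: "?E (f(b := y)) = ?E (f(b := 0)) + y *\<^sub>R b" for f y
  proof -
    have "?E (f(b := y)) = y *\<^sub>R b + (\<Sum>b'\<in>?B. f b' *\<^sub>R b')" for y
      using b by (subst sum.remove[of _ b]) (auto intro!: sum.cong)
    from this[of y] this[of 0] show ?thesis by (simp only: scaleR_zero_left add_0 add.commute)
  qed
  \<comment> \<open>Fubini with the coordinate along \<open>b\<close> innermost;
    \<open>f(b := 0)\<close> gives the foot of a line parallel to \<open>b\<close>.\<close>
  have main: "(\<integral>\<^sup>+x. g x \<partial>lborel) =
      (\<integral>\<^sup>+f. (\<integral>\<^sup>+y. g (?E (f(b := 0)) + y *\<^sub>R b) \<partial>lborel) \<partial>(\<Pi>\<^sub>M b'\<in>?B. lborel))"
    if [measurable]: "g \<in> borel_measurable borel" for g :: "'a \<Rightarrow> ennreal"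
  proof -
    have "(\<integral>\<^sup>+x. g x \<partial>lborel) = (\<integral>\<^sup>+f. g (?E f) \<partial>(\<Pi>\<^sub>M b'\<in>insert b ?B. lborel))"
      unfolding ins by (subst lborel_eq) (simp add: nn_integral_distr)
    also have "\<dots> = (\<integral>\<^sup>+f. (\<integral>\<^sup>+y. g (?E (f(b := y))) \<partial>lborel) \<partial>(\<Pi>\<^sub>M b'\<in>?B. lborel))"
      by (rule product_nn_integral_insert) (simp, simp, unfold ins, measurable)
    also have "\<dots> = (\<integral>\<^sup>+f. (\<integral>\<^sup>+y. g (?E (f(b := 0)) + y *\<^sub>R b) \<partial>lborel) \<partial>(\<Pi>\<^sub>M b'\<in>?B. lborel))"
      by (intro nn_integral_cong arg_cong[where f=g] E)
    finally show ?thesis .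
  qed
  \<comment> \<open>Along a line parallel to \<open>b\<close> the offset \<open>c\<close> is
    constant, so the map only translates that line.\<close>
  have "(\<integral>\<^sup>+y. h ((u + y *\<^sub>R b) + c (u + y *\<^sub>R b) *\<^sub>R b) \<partial>lborel) = (\<integral>\<^sup>+y. h (u + y *\<^sub>R b) \<partial>lborel)" for u
  proof -
    have "(\<integral>\<^sup>+y. h (u + y *\<^sub>R b) \<partial>lborel) = (\<integral>\<^sup>+y. h (u + (c u + y) *\<^sub>R b) \<partial>lborel)"
      by (subst (1) lborel_distr_plus[of "c u", symmetric]) (simp add: nn_integral_distr)
    thus ?thesis by (simp add: c algebra_simps)
  qed
  thus ?thesis
    using main[of h] main[of "\<lambda>x. h (x + c x *\<^sub>R b)"] by simp
qed

text \<open>Lebesgue measure is determined by its values on open boxes. The swap is an involution,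
  so the preimage of a box is the box with swapped corners, whose side lengths are the same up to
  order.\<close>

lemma lborel_distr_coordinate_transpose:
  fixes m n :: "'n::finite"
  defines "T \<equiv> (\<lambda>x::real^'n. \<chi> i. x $ Transposition.transpose m n i)"
  shows "distr lborel borel T = (lborel :: (real^'n) measure)"
proof (rule lborel_eqI[symmetric])
  have [measurable]: "T \<in> borel_measurable borel"
    unfolding T_def by (intro borel_measurable_continuous_onI continuous_intros continuous_on_vec_lambda)
  fix l u :: "real^'n" assume le: "\<And>b. b \<in> Basis \<Longrightarrow> l \<bullet> b \<le> u \<bullet> b"
  hence le': "l $ i \<le> u $ i" for i
    using le[of "axis i 1"] by (simp add: inner_axis axis_in_Basis_iff)
  have eq: "T -` box l u = box (T l) (T u)"
    by (auto simp: T_def mem_box_cart) (metis transpose_involutory)+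
  have "emeasure (distr lborel borel T) (box l u) = emeasure lborel (box (T l) (T u))"
    by (simp add: emeasure_distr eq)
  also have "\<dots> = (\<Prod>b\<in>Basis. (T u - T l) \<bullet> b)"
    by (rule emeasure_lborel_box) (auto simp: T_def Basis_vec_def inner_axis le')
  also have "(\<Prod>b\<in>Basis. (T u - T l) \<bullet> b) = (\<Prod>i\<in>UNIV. (u - l) $ Transposition.transpose m n i)"
    by (simp add: Basis_vec_def UNION_singleton_eq_range prod.reindex inj_on_def axis_eq_axis inner_axis T_def)
  also have "\<dots> = (\<Prod>i\<in>UNIV. (u - l) $ i)"
    using prod.permute[OF permutes_swap_id, where S=UNIV and g="\<lambda>i. (u - l) $ i", of m n]
    by (simp add: comp_def)
  also have "\<dots> = (\<Prod>b\<in>Basis. (u - l) \<bullet> b)"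
    by (simp add: Basis_vec_def UNION_singleton_eq_range prod.reindex inj_on_def axis_eq_axis inner_axis)
  finally show "emeasure (distr lborel borel T) (box l u) = (\<Prod>b\<in>Basis. (u - l) \<bullet> b)" .
qed simp

lemma nn_integral_lborel_stretch:
  fixes c :: "'n::finite \<Rightarrow> real" and h :: "real^'n \<Rightarrow> ennreal"
  assumes [measurable]: "h \<in> borel_measurable borel" and c: "\<And>i. c i \<noteq> 0"
  shows "(\<integral>\<^sup>+x. h x \<partial>lborel) = \<bar>prod c UNIV\<bar> * (\<integral>\<^sup>+x. h (\<chi> i. c i * x $ i) \<partial>lborel)"
proof -
  \<comment> \<open>\<open>lborel_affine_euclidean\<close> expects one factor per basis vector, so
    \<open>c\<close> is carried from the indices to the vectors \<open>axis i 1\<close>.\<close>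
  define d where "d b = c (SOME i. b = axis i 1)" for b :: "real^'n"
  have d: "d (axis i 1) = c i" for i
    unfolding d_def by (rule arg_cong[where f=c], rule some_equality) (auto simp: axis_eq_axis)
  have B: "(Basis :: (real^'n) set) = range (\<lambda>i. axis i 1)"
    by (auto simp: Basis_vec_def)
  have inj: "inj (\<lambda>i. axis i (1::real) :: real^'n)"
    by (auto simp: inj_on_def axis_eq_axis)
  have sum: "(\<Sum>j\<in>Basis. (d j * (x \<bullet> j)) *\<^sub>R j) = (\<chi> i. c i * x $ i)" for x :: "real^'n"
    unfolding B by (subst sum.reindex[OF inj], simp add: d inner_axis)
      (simp add: vec_eq_iff axis_def if_distrib[of "\<lambda>u. _ * u"] cong: if_cong)
  have prod: "(\<Prod>j\<in>Basis. \<bar>d j\<bar>) = \<bar>prod c UNIV\<bar>"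
    unfolding B by (subst prod.reindex[OF inj]) (simp add: d abs_prod)
  have [measurable]: "(\<lambda>x::real^'n. \<chi> i. c i * x $ i) \<in> borel_measurable borel"
    by (intro borel_measurable_continuous_onI continuous_intros continuous_on_vec_lambda)
  have "lborel = density (distr lborel borel (\<lambda>x::real^'n. 0 + (\<Sum>j\<in>Basis. (d j * (x \<bullet> j)) *\<^sub>R j)))
      (\<lambda>_. (\<Prod>j\<in>Basis. \<bar>d j\<bar>))"
    by (rule lborel_affine_euclidean) (auto simp: B d c)
  hence eq: "lborel = density (distr lborel borel (\<lambda>x::real^'n. \<chi> i. c i * x $ i)) (\<lambda>_. ennreal \<bar>prod c UNIV\<bar>)"
    by (simp add: sum prod)
  show ?thesis
    by (subst eq) (simp add: nn_integral_density nn_integral_distr nn_integral_cmult)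
qed

text \<open>\<open>HOL-Analysis\<close> has the change of variables only for well-ordered index types.\<close>

theorem nn_integral_lborel_linear:
  fixes f :: "real^'n::finite \<Rightarrow> real^'n" and h :: "real^'n \<Rightarrow> ennreal"
  assumes "linear f" "det (matrix f) \<noteq> 0" "h \<in> borel_measurable borel"
  shows "(\<integral>\<^sup>+x. h x \<partial>lborel) = \<bar>det (matrix f)\<bar> * (\<integral>\<^sup>+x. h (f x) \<partial>lborel)"
proof -
  \<comment> \<open>The determinant hypothesis sits inside the property so that the induction can
    pass through singular maps: a zero row makes it vacuous, and a nonzero determinant of a
    composition gives nonzero determinants of both factors.\<close>
  let ?P = "\<lambda>f::real^'n \<Rightarrow> real^'n. det (matrix f) \<noteq> 0 \<longrightarrow> (\<forall>h\<in>borel_measurable borel.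
      (\<integral>\<^sup>+x. h x \<partial>lborel) = \<bar>det (matrix f)\<bar> * (\<integral>\<^sup>+x. h (f x) \<partial>lborel))"
  have "?P f"
    using assms(1)
  proof (rule induct_linear_elementary)
    fix f g :: "real^'n \<Rightarrow> real^'n"
    assume lin: "linear f" "linear g" and P: "?P f" "?P g"
    have [measurable]: "f \<in> borel_measurable borel"
      using lin by (intro borel_measurable_continuous_onI linear_continuous_on) (simp add: linear_linear)
    have det: "det (matrix (f \<circ> g)) = det (matrix f) * det (matrix g)"
      using lin by (simp add: matrix_compose det_mul)
    show "?P (f \<circ> g)"
    proof (intro impI ballI)
      fix h :: "real^'n \<Rightarrow> ennreal" assume nz: "det (matrix (f \<circ> g)) \<noteq> 0" and [measurable]: "h \<in> borel_measurable borel"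
      have "(\<integral>\<^sup>+x. h x \<partial>lborel) = \<bar>det (matrix f)\<bar> * (\<integral>\<^sup>+x. h (f x) \<partial>lborel)"
        by (rule P(1)[rule_format]) (use nz det in simp_all)
      also have "(\<integral>\<^sup>+x. h (f x) \<partial>lborel) = \<bar>det (matrix g)\<bar> * (\<integral>\<^sup>+x. h (f (g x)) \<partial>lborel)"
        by (rule P(2)[rule_format]) (use nz det in simp_all)
      finally show "(\<integral>\<^sup>+x. h x \<partial>lborel) = \<bar>det (matrix (f \<circ> g))\<bar> * (\<integral>\<^sup>+x. h ((f \<circ> g) x) \<partial>lborel)"
        by (simp add: det abs_mult ennreal_mult mult.assoc)
    qed
  next
    fix f :: "real^'n \<Rightarrow> real^'n" and i assume "linear f" "\<And>x. f x $ i = 0"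
    hence "row i (matrix f) = 0"
      by (simp add: row_def matrix_def vec_eq_iff)
    thus "?P f" by (simp add: det_zero_row)
  next
    fix c :: "'n \<Rightarrow> real"
    have det: "det (matrix (\<lambda>x::real^'n. \<chi> i. c i * x $ i)) = prod c UNIV"
      by (subst det_diagonal) (auto simp: matrix_def axis_def)
    show "?P (\<lambda>x. \<chi> i. c i * x $ i)"
      unfolding det by (auto intro!: nn_integral_lborel_stretch)
  next
    fix m n :: 'n assume "m \<noteq> n"
    let ?h = "\<lambda>v::real^'n. \<chi> i. v $ Transposition.transpose m n i"
    have "(\<chi> i j. if Transposition.transpose m n i = j then 1 else 0) = (\<chi> i j. if j = Transposition.transpose m n i then 1 else (0::real))"
      by (auto intro!: Cart_lambda_cong)
    then have "matrix ?h = transpose (\<chi> i j. mat 1 $ i $ Transposition.transpose m n j)"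
      by (auto simp: matrix_eq transpose_def axis_def mat_def matrix_def)
    then have 1: "\<bar>det (matrix ?h)\<bar> = 1"
      by (simp add: det_permute_columns permutes_swap_id sign_swap_id abs_mult)
    have [measurable]: "?h \<in> borel_measurable borel"
      by (intro borel_measurable_continuous_onI continuous_intros continuous_on_vec_lambda)
    show "?P ?h"
      unfolding 1
      by (subst lborel_distr_coordinate_transpose[of m n, symmetric]) (simp add: nn_integral_distr)
  next
    fix m n :: 'n assume mn: "m \<noteq> n"
    let ?h = "\<lambda>v::real^'n. \<chi> i. if i = m then v $ m + v $ n else v $ i"
    \<comment> \<open>Adding one coordinate to another is a shear along \<open>axis m 1\<close>; its
      offset \<open>v $ n\<close> is constant in that direction since m and n differ.\<close>
    have h: "(\<chi> i. if i = m then v $ m + v $ n else v $ i) = v + (v $ n) *\<^sub>R axis m 1" for v :: "real^'n"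
      by (auto simp: vec_eq_iff axis_def)
    have "matrix ?h = (\<chi> k. if k = m then row m (mat 1) + 1 *s row n (mat 1) else row k (mat 1))"
      using mn by (auto simp: vec_eq_iff matrix_def row_def mat_def axis_def)
    hence 1: "det (matrix ?h) = 1"
      using det_row_operation[OF mn, of "mat 1 :: real^'n^'n" 1] by simp
    show "?P ?h"
    proof (intro impI ballI)
      fix g :: "real^'n \<Rightarrow> ennreal" assume [measurable]: "g \<in> borel_measurable borel"
      have "(\<integral>\<^sup>+x. g (x + (x $ n) *\<^sub>R axis m 1) \<partial>lborel) = (\<integral>\<^sup>+x. g x \<partial>lborel)"
        using mn by (intro nn_integral_lborel_shear)
          (simp_all add: axis_in_Basis_iff, auto simp: axis_def intro!: borel_measurable_continuous_onI continuous_intros)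
      thus "(\<integral>\<^sup>+x. g x \<partial>lborel) = \<bar>det (matrix ?h)\<bar> * (\<integral>\<^sup>+x. g (?h x) \<partial>lborel)"
        unfolding 1 by (simp only: h) simp
    qed
  qed
  thus ?thesis using assms by blast
qed

section \<open>Positive definite matrices and Gaussian integrals\<close>

text \<open>Gram-Schmidt for the inner product induced by \<open>M\<close>. As long as an index is
  missing, the family spans a proper subspace; any vector outside it, minus its projection, can be
  normalised and added.\<close>

lemma pos_def_orthonormal_family:
  fixes M :: "real^'p^'p"
  assumes M: "pos_def M"
  shows "\<exists>f :: 'p \<Rightarrow> real^'p. \<forall>i\<in>A. \<forall>j\<in>A. f i \<bullet> (M *v f j) = of_bool (i = j)"
proof (induction A rule: finite_induct[OF finite])
  case 1
  then show ?case by simp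
next
  case (2 a A)
  have sym: "x \<bullet> (M *v y) = y \<bullet> (M *v x)" for x y
    using M by (metis dot_lmul_matrix inner_commute pos_def_def transpose_matrix_vector)
  from 2 obtain f where f: "f i \<bullet> (M *v f j) = of_bool (i = j)" if "i \<in> A" "j \<in> A" for i j
    by blast
  have "card A < CARD('p)"
    using 2 by (metis finite iso_tuple_UNIV_I psubset_card_mono subset_UNIV psubsetI)
  hence "dim (span (f ` A)) < DIM(real^'p)"
    using dim_le_card'[of "f ` A"] card_image_le[of A f] by (simp add: dim_span)
  hence "span (f ` A) \<noteq> UNIV"
    by (metis dim_UNIV less_irrefl)
  then obtain w where w: "w \<notin> span (f ` A)" by blast
  define v where "v = w - (\<Sum>i\<in>A. (w \<bullet> (M *v f i)) *\<^sub>R f i)"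
  have "(\<Sum>i\<in>A. (w \<bullet> (M *v f i)) *\<^sub>R f i) \<in> span (f ` A)"
    by (intro span_sum span_scale span_base) auto
  hence "v \<noteq> 0" using w by (auto simp: v_def)
  hence pos: "v \<bullet> (M *v v) > 0" using M by (simp add: pos_def_def)
  have orth: "v \<bullet> (M *v f j) = 0" if "j \<in> A" for j
    using that by (simp add: v_def inner_diff_left inner_sum_left f sum.delta)
  define u where "u = (1 / sqrt (v \<bullet> (M *v v))) *\<^sub>R v"
  have "u \<bullet> (M *v u) = 1"
    using pos by (simp add: u_def matrix_vector_mult_scaleR field_simps)
  moreover have "u \<bullet> (M *v f j) = 0" "f j \<bullet> (M *v u) = 0" if "j \<in> A" for j
    using orth[OF that] sym[of "f j" u] by (simp_all add: u_def)
  ultimately have "\<forall>i\<in>insert a A. \<forall>j\<in>insert a A. (f(a := u)) i \<bullet> (M *v (f(a := u)) j) = of_bool (i = j)"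
    using f 2(2) by auto
  then show ?case by blast
qed

text \<open>The columns of \<open>C\<close> are an orthonormal basis for the inner product induced
  by \<open>M\<close>. \<open>C\<close> does the work of an inverse square root of \<open>M\<close>
  without any spectral theorem.\<close>

lemma pos_def_congruent_mat_1:
  fixes M :: "real^'p^'p"
  assumes "pos_def M"
  obtains C :: "real^'p^'p" where "transpose C ** M ** C = mat 1" "det M * (det C)\<^sup>2 = 1"
proof -
  obtain f :: "'p \<Rightarrow> real^'p" where f: "\<And>i j. f i \<bullet> (M *v f j) = of_bool (i = j)"
    using pos_def_orthonormal_family[OF assms, of UNIV] by auto
  define C :: "real^'p^'p" where "C = transpose (\<chi> i. f i)"
  have *: "transpose C ** M ** C = mat 1"
  proof -
    have "(transpose C ** M ** C) $ i $ j = f i \<bullet> (M *v f j)" for i j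
    proof -
      have "(transpose C ** M ** C) $ i $ j = (transpose C ** (M ** C)) $ i $ j"
        by (simp add: matrix_mul_assoc)
      thus ?thesis
        by (simp add: C_def matrix_matrix_mult_def transpose_def inner_vec_def matrix_vector_mult_def)
    qed
    thus ?thesis by (simp add: vec_eq_iff mat_def f)
  qed
  moreover from * have "det (transpose C ** M ** C) = 1" by (simp only: det_I)
  hence "det M * (det C)\<^sup>2 = 1" by (simp add: det_mul power2_eq_square mult_ac)
  ultimately show ?thesis using that by blast
qed

lemma det_pos_def:
  assumes "pos_def M"
  shows "det M > 0"
proof -
  obtain C where C: "transpose C ** M ** C = mat 1" "det M * (det C)\<^sup>2 = 1"
    using pos_def_congruent_mat_1[OF assms] .
  have "0 < det M * (det C)\<^sup>2" unfolding C(2) by (rule zero_less_one)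
  thus ?thesis by (rule zero_less_mult_pos2) (use C(2) in \<open>cases "det C = 0"; force\<close>)
qed

lemma invertible_pos_def: "pos_def M \<Longrightarrow> invertible M"
  using det_pos_def[of M] by (simp add: invertible_det_nz)

lemma
  fixes M :: "real^'p^'p"
  assumes "pos_def M"
  shows pos_def_matrix_inv_mult: "matrix_inv M ** M = mat 1" "M ** matrix_inv M = mat 1"
    and pos_def_matrix_inv_mult_vec: "matrix_inv M *v (M *v x) = x" "M *v (matrix_inv M *v x) = x"
proof -
  show 1: "matrix_inv M ** M = mat 1" and 2: "M ** matrix_inv M = mat 1"
    using someI_ex[OF invertible_pos_def[OF assms, unfolded invertible_def]]
    by (simp_all add: matrix_inv_def)
  show "matrix_inv M *v (M *v x) = x" "M *v (matrix_inv M *v x) = x"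
    using 1 2 by (simp_all add: matrix_vector_mul_assoc)
qed

lemma matrix_inv_unique_pos_def:
  fixes M :: "real^'p^'p"
  assumes "pos_def M" "N ** M = mat 1"
  shows "matrix_inv M = N"
  using assms pos_def_matrix_inv_mult(2)[OF assms(1)]
  by (metis matrix_mul_assoc matrix_mul_lid matrix_mul_rid)

lemma pos_def_matrix_inv:
  fixes M :: "real^'p^'p"
  assumes M: "pos_def M"
  shows "pos_def (matrix_inv M)"
  unfolding pos_def_def
proof (intro conjI allI impI)
  have "transpose M = M" using M by (simp add: pos_def_def)
  hence "transpose (matrix_inv M) ** M = mat 1"
    using arg_cong[OF pos_def_matrix_inv_mult(2)[OF M], of transpose]
    by (simp add: matrix_transpose_mul)
  thus "transpose (matrix_inv M) = matrix_inv M"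
    by (rule matrix_inv_unique_pos_def[OF M, symmetric])
  fix v :: "real^'p" assume "v \<noteq> 0"
  let ?w = "matrix_inv M *v v"
  have v: "M *v ?w = v" by (rule pos_def_matrix_inv_mult_vec[OF M])
  hence "?w \<noteq> 0" using \<open>v \<noteq> 0\<close> by auto
  hence "?w \<bullet> (M *v ?w) > 0" using M by (simp add: pos_def_def)
  thus "v \<bullet> (matrix_inv M *v v) > 0" unfolding v by (simp add: inner_commute)
qed

lemma matrix_inv_matrix_inv_pos_def:
  "pos_def M \<Longrightarrow> matrix_inv (matrix_inv M) = M"
  by (simp add: matrix_inv_unique_pos_def pos_def_matrix_inv pos_def_matrix_inv_mult)

lemma det_matrix_inv_pos_def: "pos_def M \<Longrightarrow> det (matrix_inv M) = 1 / det M"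
  using det_mul[of "matrix_inv M" M] det_pos_def[of M]
  by (simp add: pos_def_matrix_inv_mult field_simps)

lemma pos_def_scaleR: "pos_def M \<Longrightarrow> c > 0 \<Longrightarrow> pos_def (c *\<^sub>R M)"
  by (simp add: pos_def_def transpose_scalar scaleR_matrix_vector_assoc[symmetric])

lemma matrix_inv_scaleR_pos_def:
  "pos_def M \<Longrightarrow> c > 0 \<Longrightarrow> matrix_inv (c *\<^sub>R M) = (1 / c) *\<^sub>R matrix_inv M"
  by (intro matrix_inv_unique_pos_def pos_def_scaleR)
    (simp_all add: pos_def_matrix_inv_mult scalar_matrix_assoc[symmetric] matrix_scalar_ac)

lemma inner_pos_def_commute:
  fixes M :: "real^'p^'p"
  shows "pos_def M \<Longrightarrow> x \<bullet> (M *v y) = y \<bullet> (M *v x)"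
  by (metis dot_lmul_matrix inner_commute pos_def_def transpose_matrix_vector)

section \<open>Gaussian integrals and normalisation of the density\<close>

lemma nn_integral_std_gaussian:
  "(\<integral>\<^sup>+(x::real^'p). exp (- (x \<bullet> x) / 2) \<partial>lborel) = sqrt ((2 * pi) ^ CARD('p))"
proof -
  have 1: "(\<integral>\<^sup>+(t::real). exp (- (t\<^sup>2 / 2)) \<partial>lborel) = sqrt (2 * pi)"
  proof -
    have "(\<integral>\<^sup>+(t::real). exp (- (t\<^sup>2 / 2)) \<partial>lborel) = (\<integral>\<^sup>+(t::real). ennreal (sqrt (2 * pi)) * std_normal_density t \<partial>lborel)"
      by (intro nn_integral_cong) (simp add: std_normal_density_def ennreal_mult''[symmetric])
    also have "\<dots> = sqrt (2 * pi)"
      by (simp add: nn_integral_cmult nn_integral_eq_integral)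
    finally show ?thesis .
  qed
  have "(\<integral>\<^sup>+(x::real^'p). exp (- (x \<bullet> x) / 2) \<partial>lborel) =
      (\<integral>\<^sup>+(x::real^'p). (\<Prod>b\<in>Basis. ennreal (exp (- (x \<bullet> b)\<^sup>2 / 2))) \<partial>lborel)"
  proof (intro nn_integral_cong)
    fix x :: "real^'p"
    have "x \<bullet> x = (\<Sum>b\<in>Basis. (x \<bullet> b)\<^sup>2)"
      by (subst euclidean_inner) (simp add: power2_eq_square)
    thus "ennreal (exp (- (x \<bullet> x) / 2)) = (\<Prod>b\<in>Basis. ennreal (exp (- (x \<bullet> b)\<^sup>2 / 2)))"
      by (simp add: prod_ennreal exp_sum[symmetric] sum_negf sum_divide_distrib[symmetric])
  qed
  also have "\<dots> = (\<Prod>b\<in>(Basis::(real^'p) set). ennreal (sqrt (2 * pi)))"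
    by (subst nn_integral_lborel_prod) (simp_all add: 1)
  also have "\<dots> = sqrt ((2 * pi) ^ CARD('p))"
    by (simp add: ennreal_power real_sqrt_power power_mult_distrib real_sqrt_mult)
  finally show ?thesis .
qed

lemma nn_integral_lborel_translate:
  fixes h :: "'a::euclidean_space \<Rightarrow> ennreal"
  assumes "h \<in> borel_measurable borel"
  shows "(\<integral>\<^sup>+x. h (c + x) \<partial>lborel) = (\<integral>\<^sup>+x. h x \<partial>lborel)"
  using assms by (subst (2) lborel_distr_plus[of c, symmetric]) (simp add: nn_integral_distr)

lemma borel_measurable_matrix_vector_mult[measurable]:
  fixes M :: "real^'n^'m"
  assumes [measurable]: "f \<in> borel_measurable N"
  shows "(\<lambda>x. M *v f x) \<in> borel_measurable N"
proof -
  have [measurable]: "(*v) M \<in> borel_measurable borel"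
    by (intro borel_measurable_continuous_onI matrix_vector_mult_linear_continuous_on)
  show ?thesis by measurable
qed

text \<open>Substituting \<open>C *v x\<close> turns the quadratic form into
  \<open>x \<bullet> x\<close>; the Jacobian is the absolute value of \<open>det C\<close>, that is
  1 / sqrt (det M).\<close>

theorem nn_integral_gaussian:
  fixes M :: "real^'p^'p"
  assumes M: "pos_def M"
  shows "(\<integral>\<^sup>+x. exp (- (x \<bullet> (M *v x)) / 2) \<partial>lborel) = sqrt ((2 * pi) ^ CARD('p) / det M)"
proof -
  obtain C where C: "transpose C ** M ** C = mat 1" "det M * (det C)\<^sup>2 = 1"
    using pos_def_congruent_mat_1[OF M] .
  have "x \<bullet> x = (C *v x) \<bullet> (M *v (C *v x))" for x
  proof -
    have "x \<bullet> (transpose C *v w) = (C *v x) \<bullet> w" for w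
      by (simp only: dot_lmul_matrix[symmetric] vector_transpose_matrix)
    hence "x \<bullet> ((transpose C ** M ** C) *v x) = (C *v x) \<bullet> (M *v (C *v x))"
      by (simp only: matrix_vector_mul_assoc[symmetric])
    thus ?thesis using C by simp
  qed
  hence eq: "(\<integral>\<^sup>+x. exp (- (x \<bullet> (M *v x)) / 2) \<partial>lborel) = \<bar>det C\<bar> * (\<integral>\<^sup>+(x::real^'p). exp (- (x \<bullet> x) / 2) \<partial>lborel)"
    using C(2) by (subst nn_integral_lborel_linear[of "(*v) C"]) auto
  have "(det C)\<^sup>2 = 1 / det M"
    using C(2) det_pos_def[OF M] by (simp add: field_simps)
  hence "\<bar>det C\<bar> = sqrt (1 / det M)"
    by (metis real_sqrt_abs)
  with eq have "(\<integral>\<^sup>+x. exp (- (x \<bullet> (M *v x)) / 2) \<partial>lborel) =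
      ennreal (sqrt (1 / det M)) * ennreal (sqrt ((2 * pi) ^ CARD('p)))"
    by (simp only: nn_integral_std_gaussian)
  thus ?thesis
    by (simp add: real_sqrt_divide flip: ennreal_mult'')
qed

lemma borel_measurable_gauss_density[measurable]: "gauss_density \<mu> S \<in> borel_measurable borel"
  unfolding gauss_density_def[abs_def] by measurable

lemma gauss_density_pos: "pos_def S \<Longrightarrow> gauss_density \<mu> S x > 0"
  using det_pos_def[of S] by (simp add: gauss_density_def)

lemma nn_integral_gauss_density:
  fixes S :: "real^'p^'p"
  assumes S: "pos_def S"
  shows "(\<integral>\<^sup>+x. gauss_density \<mu> S x \<partial>lborel) = 1"
proof -
  let ?c = "sqrt ((2 * pi) ^ CARD('p) * det S)"
  have c: "?c > 0" using det_pos_def[OF S] by simp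
  have "(\<integral>\<^sup>+x. gauss_density \<mu> S x \<partial>lborel) = (\<integral>\<^sup>+x. gauss_density \<mu> S (\<mu> + x) \<partial>lborel)"
    by (rule nn_integral_lborel_translate[symmetric]) measurable
  also have "\<dots> = (\<integral>\<^sup>+x. ennreal (1 / ?c) * exp (- (x \<bullet> (matrix_inv S *v x)) / 2) \<partial>lborel)"
    using c by (intro nn_integral_cong) (simp add: gauss_density_def ennreal_mult''[symmetric])
  also have "\<dots> = ennreal (1 / ?c) * ennreal ?c"
    using nn_integral_gaussian[OF pos_def_matrix_inv[OF S]]
    by (simp add: nn_integral_cmult det_matrix_inv_pos_def[OF S])
  also have "\<dots> = 1"
    using c det_pos_def[OF S] by (simp flip: ennreal_mult'')
  finally show ?thesis .
qed

section \<open>The tangent bound and the Gaussian variational posterior\<close>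

text \<open>The numerator of the derivative vanishes at 0 and is itself nonincreasing, hence
  nonpositive. This monotonicity is the concavity behind the tangent bound.\<close>

lemma tanh_over_self_antimono:
  fixes a b :: real
  assumes "0 < a" "a \<le> b"
  shows "tanh b / b \<le> tanh a / a"
proof -
  have k: "u * (1 - (tanh u)\<^sup>2) - tanh u \<le> 0" if "0 \<le> u" for u :: real
  proof -
    let ?k = "\<lambda>u::real. u * (1 - (tanh u)\<^sup>2) - tanh u"
    have "?k u \<le> ?k 0"
    proof (rule DERIV_nonpos_imp_nonincreasing[OF that], intro exI conjI)
      fix x :: real assume x: "0 \<le> x" "x \<le> u"
      show "(?k has_real_derivative (- 2 * x * tanh x * (1 - (tanh x)\<^sup>2))) (at x)"
        by (auto intro!: derivative_eq_intros simp: algebra_simps power2_eq_square)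
      show "- 2 * x * tanh x * (1 - (tanh x)\<^sup>2) \<le> 0"
        using x tanh_real_bounds[of x] by (auto simp: mult_le_0_iff abs_square_le_1 abs_le_iff intro!: mult_nonneg_nonneg)
    qed
    thus ?thesis by simp
  qed
  show ?thesis
  proof (rule DERIV_nonpos_imp_nonincreasing[OF assms(2)], intro exI conjI)
    fix x :: real assume x: "a \<le> x" "x \<le> b"
    show "((\<lambda>u. tanh u / u) has_real_derivative ((x * (1 - (tanh x)\<^sup>2) - tanh x) / x\<^sup>2)) (at x)"
      using x assms by (auto intro!: derivative_eq_intros simp: field_simps power2_eq_square)
    show "(x * (1 - (tanh x)\<^sup>2) - tanh x) / x\<^sup>2 \<le> 0"
      using k[of x] x assms by (auto intro!: divide_nonpos_nonneg)
  qed
qed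

lemma tanh_le_self:
  assumes "0 \<le> (x::real)"
  shows "tanh x \<le> x"
proof -
  have "tanh x - x \<le> tanh 0 - 0"
  proof (rule DERIV_nonpos_imp_nonincreasing[OF assms], intro exI conjI)
    fix u :: real
    show "((\<lambda>u. tanh u - u) has_real_derivative (- (tanh u)\<^sup>2)) (at u)"
      by (auto intro!: derivative_eq_intros)
  qed simp
  thus ?thesis by simp
qed

lemma A_fun_minus [simp]: "A_fun (- t) = A_fun t"
  by (simp add: A_fun_def)

lemma A_fun_nonpos: "A_fun t \<le> 0"
  by (cases "t > 0") (auto simp: A_fun_def field_simps zero_le_divide_iff)

lemma A_fun_mono:
  assumes "0 \<le> s" "s \<le> t"
  shows "A_fun s \<le> A_fun t"
proof (cases "s = 0")
  case True
  have "tanh (t / 2) \<le> t / 2" using assms by (intro tanh_le_self) auto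
  thus ?thesis using True assms by (auto simp: A_fun_def field_simps)
next
  case False
  thus ?thesis using assms tanh_over_self_antimono[of "s / 2" "t / 2"]
    by (auto simp: A_fun_def field_simps)
qed

text \<open>By evenness and monotonicity the minimum is at 0. This caps the curvature of the
  minorant uniformly in \<xi> and is the source of the factor 1/4 in the isotropic precision used
  for the evidence.\<close>

lemma A_fun_ge: "- 1 / 8 \<le> A_fun t"
  using A_fun_mono[of 0 "\<bar>t\<bar>"] by (cases "t \<ge> 0") (auto simp: A_fun_def[of 0] abs_if split: if_splits)

text \<open>Clearing the denominator absorbs the special value at 0, where both sides
  vanish.\<close>

lemma A_fun_mult: "4 * t * A_fun t = - tanh (t / 2)"
  by (simp add: A_fun_def)

text \<open>In this form \<open>A_fun s * t\<^sup>2 + C_fun s\<close> is visibly a line in the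
  variable t^2: at t = s the quadratic terms cancel and the bounded function itself remains.\<close>

lemma C_fun_eq: "C_fun t = t / 2 - ln (1 + exp t) - A_fun t * t\<^sup>2"
proof -
  have "4 * (A_fun t * t\<^sup>2) = t * (4 * t * A_fun t)"
    by (simp add: power2_eq_square)
  thus ?thesis unfolding A_fun_mult by (simp add: C_fun_def)
qed

lemma ln_one_plus_exp_minus: "ln (1 + exp (- t)) + t / 2 = ln (1 + exp t) - t / (2::real)"
proof -
  have "1 + exp (- t) = (1 + exp t) * exp (- t)"
    by (simp add: algebra_simps flip: exp_add)
  hence "ln (1 + exp (- t)) = ln (1 + exp t) - t"
    using add_pos_pos[OF zero_less_one exp_gt_zero[of t]] by (simp add: ln_mult_pos)
  thus ?thesis by simp
qed

text \<open>The tangent bound of Jaakkola and Jordan: \<open>ln (1 + exp t) - t / 2\<close> is even and concave as a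
  function of \<open>t\<^sup>2\<close>, with slope \<open>- A_fun t\<close>.\<close>

theorem tangent_bound:
  "A_fun s * t\<^sup>2 + C_fun s \<le> t / 2 - ln (1 + exp t)"
proof -
  define F where "F t = ln (1 + exp t) - t / 2" for t :: real
  have even: "F \<bar>t\<bar> = F t" for t
    using ln_one_plus_exp_minus[of t] by (simp add: F_def abs_if)
  have "A_fun s * (t\<^sup>2 - s\<^sup>2) - F s \<le> - F t" if "0 \<le> s" "0 \<le> t" for s t
  proof -
    \<comment> \<open>The gap vanishes at s. By monotonicity of \<open>A_fun\<close> its derivative
      is nonpositive on [0, s] and nonnegative beyond, so s minimises it; evenness later extends the
      bound to all signs.\<close>
    let ?\<phi> = "\<lambda>t. F s - A_fun s * (t\<^sup>2 - s\<^sup>2) - F t"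
    have deriv: "(?\<phi> has_real_derivative (2 * x * (A_fun x - A_fun s))) (at x)" for x
    proof -
      have e: "exp x / (1 + exp x) - 1 / 2 = tanh (x / 2) / 2"
      proof -
        define u where "u = exp (x / 2)"
        have "u > 0" by (simp add: u_def)
        hence pos: "u > 0" "1 + u * u > 0" by (simp_all add: add_pos_pos)
        have sq: "exp x = u * u" by (simp add: u_def flip: exp_add)
        have "tanh (x / 2) = (u - 1 / u) / (u + 1 / u)"
          by (simp add: tanh_altdef u_def exp_minus field_simps)
        also have "\<dots> = (u * u - 1) / (1 + u * u)"
          using pos by (simp add: divide_simps)
        finally have tanh: "tanh (x / 2) = (u * u - 1) / (1 + u * u)" .
        show ?thesis
          unfolding tanh sq using pos by (simp add: field_simps)
      qed
      have "(?\<phi> has_real_derivative (- 2 * x * A_fun s - (exp x / (1 + exp x) - 1 / 2))) (at x)"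
        unfolding F_def using add_pos_pos[OF zero_less_one exp_gt_zero[of x]]
        by (auto intro!: derivative_eq_intros)
      also have "- 2 * x * A_fun s - (exp x / (1 + exp x) - 1 / 2) = 2 * x * (A_fun x - A_fun s)"
        unfolding e using A_fun_mult[of x] by (simp add: algebra_simps)
      finally show ?thesis .
    qed
    have "0 \<le> ?\<phi> t"
    proof (cases "s \<le> t")
      case True
      have "?\<phi> s \<le> ?\<phi> t"
        by (rule DERIV_nonneg_imp_nondecreasing[OF True], intro exI conjI, rule deriv)
          (use that in \<open>auto intro!: mult_nonneg_nonneg A_fun_mono\<close>)
      thus ?thesis by simp
    next
      case False
      hence "t \<le> s" by simp
      have "?\<phi> s \<le> ?\<phi> t"
        by (rule DERIV_nonpos_imp_nonincreasing[OF \<open>t \<le> s\<close>, where f = ?\<phi>], intro exI conjI, rule deriv)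
          (use that in \<open>auto intro!: mult_nonneg_nonpos A_fun_mono\<close>)
      thus ?thesis by simp
    qed
    thus ?thesis by simp
  qed
  from this[OF abs_ge_zero abs_ge_zero, of s t] have "A_fun s * (t\<^sup>2 - s\<^sup>2) - F s \<le> - F t"
    unfolding even power2_abs by (cases "s \<ge> 0") simp_all
  thus ?thesis by (simp add: C_fun_eq F_def algebra_simps)
qed

section \<open>The log-likelihood, its tangent minorant and the resulting Gaussian\<close>

definition log_lik :: "nat \<Rightarrow> (nat \<Rightarrow> real ^ 'p) \<Rightarrow> (nat \<Rightarrow> bool) \<Rightarrow> real ^ 'p \<Rightarrow> real" where
  "log_lik n X y \<beta> = (\<Sum>i<n. of_bool (y i) * (X i \<bullet> \<beta>) - ln (1 + exp (X i \<bullet> \<beta>)))"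

definition tangent_log_lik ::
  "nat \<Rightarrow> (nat \<Rightarrow> real ^ 'p) \<Rightarrow> (nat \<Rightarrow> bool) \<Rightarrow> (nat \<Rightarrow> real) \<Rightarrow> real ^ 'p \<Rightarrow> real" where
  "tangent_log_lik n X y \<xi> \<beta> =
     Xt_centred n X y \<bullet> \<beta> + \<beta> \<bullet> (XtAX n X \<xi> *v \<beta>) + (\<Sum>i<n. C_fun (\<xi> i))"

lemma XtAX_mult_vec: "XtAX n X \<xi> *v v = (\<Sum>i<n. (A_fun (\<xi> i) * (X i \<bullet> v)) *\<^sub>R X i)"
proof -
  have "(XtAX n X \<xi> *v v) $ j = (\<Sum>i<n. (A_fun (\<xi> i) * (X i \<bullet> v)) *\<^sub>R X i) $ j" for j
    unfolding matrix_vector_mult_def XtAX_def inner_vec_def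
    by (simp add: sum_distrib_left sum_distrib_right mult_ac, subst sum.swap, simp)
  thus ?thesis by (simp add: vec_eq_iff)
qed

lemma inner_XtAX: "v \<bullet> (XtAX n X \<xi> *v w) = (\<Sum>i<n. A_fun (\<xi> i) * (X i \<bullet> v) * (X i \<bullet> w))"
  by (simp add: XtAX_mult_vec inner_sum_right inner_commute mult_ac)

lemma transpose_XtAX [simp]: "transpose (XtAX n X \<xi>) = XtAX n X \<xi>"
  by (simp add: XtAX_def transpose_def mult_ac)

lemma tangent_log_lik_altdef:
  "tangent_log_lik n X y \<xi> \<beta> =
     (\<Sum>i<n. (of_bool (y i) - 1 / 2) * (X i \<bullet> \<beta>) + (A_fun (\<xi> i) * (X i \<bullet> \<beta>)\<^sup>2 + C_fun (\<xi> i)))"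
  by (simp add: tangent_log_lik_def Xt_centred_def inner_sum_left inner_XtAX sum.distrib
      power2_eq_square mult.assoc)

lemma tangent_log_lik_le: "tangent_log_lik n X y \<xi> \<beta> \<le> log_lik n X y \<beta>"
  unfolding tangent_log_lik_altdef log_lik_def
proof (rule sum_mono)
  fix i
  show "(of_bool (y i) - 1 / 2) * (X i \<bullet> \<beta>) + (A_fun (\<xi> i) * (X i \<bullet> \<beta>)\<^sup>2 + C_fun (\<xi> i))
      \<le> of_bool (y i) * (X i \<bullet> \<beta>) - ln (1 + exp (X i \<bullet> \<beta>))"
    using tangent_bound[of "\<xi> i" "X i \<bullet> \<beta>"] by (simp add: algebra_simps)
qed

lemma tangent_log_lik_eq: "tangent_log_lik n X y (\<lambda>i. X i \<bullet> \<beta>) \<beta> = log_lik n X y \<beta>"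
  unfolding tangent_log_lik_altdef log_lik_def
  by (intro sum.cong) (simp_all add: C_fun_eq algebra_simps)

text \<open>The inverse of \<open>Sigma_post\<close>, kept uninverted because the exponent of the
  Gaussian contains the precision; its positivity comes from the prior term, as \<open>A_fun\<close>
  is nonpositive.\<close>

definition post_precision ::
  "nat \<Rightarrow> (nat \<Rightarrow> real ^ 'p) \<Rightarrow> real \<Rightarrow> real ^ 'p ^ 'p \<Rightarrow> (nat \<Rightarrow> real) \<Rightarrow> real ^ 'p ^ 'p" where
  "post_precision n X \<alpha> S \<xi> = (1 / \<alpha>) *\<^sub>R matrix_inv S - 2 *\<^sub>R XtAX n X \<xi>"

lemma post_precision_mult_vec:
  "post_precision n X \<alpha> S \<xi> *v v = (1 / \<alpha>) *\<^sub>R (matrix_inv S *v v) - 2 *\<^sub>R (XtAX n X \<xi> *v v)"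
  by (simp add: post_precision_def matrix_vector_mult_diff_rdistrib scaleR_matrix_vector_assoc)

lemma pos_def_post_precision:
  fixes S :: "real^'p^'p"
  assumes "0 < \<alpha>" "pos_def S"
  shows "pos_def (post_precision n X \<alpha> S \<xi>)"
  unfolding pos_def_def
proof (intro conjI allI impI)
  show "transpose (post_precision n X \<alpha> S \<xi>) = post_precision n X \<alpha> S \<xi>"
    using pos_def_matrix_inv[OF assms(2)] transpose_XtAX[of n X \<xi>]
    by (simp add: post_precision_def pos_def_def transpose_def vec_eq_iff)
  fix v :: "real^'p" assume "v \<noteq> 0"
  hence "0 < (1 / \<alpha>) * (v \<bullet> (matrix_inv S *v v))"
    using pos_def_matrix_inv[OF assms(2)] assms(1) by (simp add: pos_def_def)
  moreover have "v \<bullet> (XtAX n X \<xi> *v v) \<le> 0"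
    unfolding inner_XtAX by (intro sum_nonpos)
      (simp add: mult.assoc mult_nonpos_nonneg A_fun_nonpos)
  ultimately show "v \<bullet> (post_precision n X \<alpha> S \<xi> *v v) > 0"
    unfolding post_precision_mult_vec inner_diff_right inner_scaleR_right by linarith
qed

lemma Sigma_post_altdef: "Sigma_post n X \<alpha> S \<xi> = matrix_inv (post_precision n X \<alpha> S \<xi>)"
  by (simp add: Sigma_post_def post_precision_def)

text \<open>The tempering \<alpha> multiplies the whole quadratic form, so the precision of q0 is
  \<alpha> times \<open>post_precision\<close>.\<close>

definition post_cov ::
  "nat \<Rightarrow> (nat \<Rightarrow> real ^ 'p) \<Rightarrow> real \<Rightarrow> real ^ 'p ^ 'p \<Rightarrow> (nat \<Rightarrow> real) \<Rightarrow> real ^ 'p ^ 'p" where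
  "post_cov n X \<alpha> S \<xi> = (1 / \<alpha>) *\<^sub>R Sigma_post n X \<alpha> S \<xi>"

lemma
  fixes S :: "real^'p^'p"
  assumes "0 < \<alpha>" "pos_def S"
  shows pos_def_post_cov: "pos_def (post_cov n X \<alpha> S \<xi>)"
    and matrix_inv_post_cov: "matrix_inv (post_cov n X \<alpha> S \<xi>) = \<alpha> *\<^sub>R post_precision n X \<alpha> S \<xi>"
proof -
  note P = pos_def_post_precision[OF assms, of n X \<xi>]
  show "pos_def (post_cov n X \<alpha> S \<xi>)"
    unfolding post_cov_def Sigma_post_altdef using assms by (intro pos_def_scaleR pos_def_matrix_inv P) simp
  show "matrix_inv (post_cov n X \<alpha> S \<xi>) = \<alpha> *\<^sub>R post_precision n X \<alpha> S \<xi>"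
    unfolding post_cov_def Sigma_post_altdef
    using assms by (simp add: matrix_inv_scaleR_pos_def pos_def_matrix_inv P matrix_inv_matrix_inv_pos_def)
qed

lemma pos_def_complete_square:
  fixes M :: "real^'p^'p"
  assumes "pos_def M"
  shows "(x - y) \<bullet> (M *v (x - y)) = x \<bullet> (M *v x) - 2 * (x \<bullet> (M *v y)) + y \<bullet> (M *v y)"
  using inner_pos_def_commute[OF assms, of x y]
  by (simp add: matrix_vector_mult_diff_distrib inner_diff_left inner_diff_right)

lemma exp_log_p_tangent:
  assumes "pos_def S"
  shows "exp (log_p_tangent n X \<alpha> \<mu> S y \<xi> \<beta>) = exp (\<alpha> * tangent_log_lik n X y \<xi> \<beta>) * gauss_density \<mu> S \<beta>"
  using gauss_density_pos[OF assms, of \<mu> \<beta>]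
  by (simp add: log_p_tangent_def tangent_log_lik_def exp_add)

text \<open>Completing the square: the exponent has quadratic part given by \<alpha> times
  \<open>post_precision\<close> and linear part \<alpha> b, so its centre solves
  \<open>?P *v ?m = b\<close>. Existence of a factor is enough here, since integrating the identity
  will name it.\<close>

lemma exp_log_p_tangent_proportional:
  fixes S :: "real^'p^'p"
  assumes \<alpha>: "0 < \<alpha>" and S: "pos_def S"
  shows "\<exists>K>0. \<forall>\<beta>. exp (log_p_tangent n X \<alpha> \<mu> S y \<xi> \<beta>) =
    K * gauss_density (mu_post n X \<alpha> \<mu> S y \<xi>) (post_cov n X \<alpha> S \<xi>) \<beta>"
proof -
  let ?P = "post_precision n X \<alpha> S \<xi>" and ?V = "post_cov n X \<alpha> S \<xi>"
  define b where "b = Xt_centred n X y + (1 / \<alpha>) *\<^sub>R (matrix_inv S *v \<mu>)"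
  let ?m = "mu_post n X \<alpha> \<mu> S y \<xi>"
  note P = pos_def_post_precision[OF assms, of n X \<xi>]
  note Si = pos_def_matrix_inv[OF S]
  have sym: "v v* matrix_inv M = matrix_inv M *v v" if "pos_def M" for M :: "real^'p^'p" and v
    using pos_def_matrix_inv[OF that] by (metis pos_def_def transpose_matrix_vector)
  have m: "?P *v ?m = b"
    by (simp add: b_def mu_post_def Sigma_post_altdef sym[OF P] sym[OF S] pos_def_matrix_inv_mult_vec[OF P])
  \<comment> \<open>\<open>c\<close> gathers what is free of \<beta> after completing the square;
    \<open>N\<close> exchanges the normalising constants of prior and posterior.\<close>
  define c where "c = \<alpha> * (\<Sum>i<n. C_fun (\<xi> i)) - (\<mu> \<bullet> (matrix_inv S *v \<mu>)) / 2 + \<alpha> / 2 * (?m \<bullet> b)"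
  define N where "N = sqrt ((2 * pi) ^ CARD('p) * det ?V) / sqrt ((2 * pi) ^ CARD('p) * det S)"
  have "N > 0" using det_pos_def[OF S] det_pos_def[OF pos_def_post_cov[OF assms, of n X \<xi>]]
    by (simp add: N_def)
  have "exp (log_p_tangent n X \<alpha> \<mu> S y \<xi> \<beta>) = (N * exp c) * gauss_density ?m ?V \<beta>" for \<beta>
  proof -
    have 1: "(\<beta> - ?m) \<bullet> (matrix_inv ?V *v (\<beta> - ?m)) =
        \<alpha> * (\<beta> \<bullet> (?P *v \<beta>)) - 2 * \<alpha> * (\<beta> \<bullet> b) + \<alpha> * (?m \<bullet> b)"
      unfolding matrix_inv_post_cov[OF assms] scaleR_matrix_vector_assoc[symmetric] inner_scaleR_right
        pos_def_complete_square[OF P] m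
      by (simp add: algebra_simps)
    have 2: "\<alpha> * (\<beta> \<bullet> (?P *v \<beta>)) = \<beta> \<bullet> (matrix_inv S *v \<beta>) - 2 * \<alpha> * (\<beta> \<bullet> (XtAX n X \<xi> *v \<beta>))"
      using \<alpha> by (simp add: post_precision_mult_vec inner_diff_right algebra_simps)
    have 3: "\<alpha> * (\<beta> \<bullet> b) = \<alpha> * (Xt_centred n X y \<bullet> \<beta>) + \<beta> \<bullet> (matrix_inv S *v \<mu>)"
      using \<alpha> by (simp add: b_def inner_add_right distrib_left inner_commute)
    have "\<alpha> * tangent_log_lik n X y \<xi> \<beta> + - ((\<beta> - \<mu>) \<bullet> (matrix_inv S *v (\<beta> - \<mu>))) / 2 =
        c + - ((\<beta> - ?m) \<bullet> (matrix_inv ?V *v (\<beta> - ?m))) / 2"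
      unfolding 1 pos_def_complete_square[OF Si] using 2 3
      by (simp add: c_def tangent_log_lik_def algebra_simps add_divide_distrib diff_divide_distrib)
    hence "exp (\<alpha> * tangent_log_lik n X y \<xi> \<beta>) * exp (- ((\<beta> - \<mu>) \<bullet> (matrix_inv S *v (\<beta> - \<mu>))) / 2) =
        exp c * exp (- ((\<beta> - ?m) \<bullet> (matrix_inv ?V *v (\<beta> - ?m))) / 2)"
      by (simp only: exp_add[symmetric])
    thus ?thesis
      unfolding exp_log_p_tangent[OF S] gauss_density_def N_def
      using det_pos_def[OF S] det_pos_def[OF pos_def_post_cov[OF assms, of n X \<xi>]]
      by (simp add: divide_simps mult_ac)
  qed
  with \<open>N > 0\<close> show ?thesis by (intro exI[of _ "N * exp c"]) simp
qed

text \<open>The normaliser Z(\<xi>) of the overview as a real number; the conversion by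
  \<open>enn2real\<close> is faithful because the integral turns out to be finite.\<close>

definition evidence ::
  "nat \<Rightarrow> (nat \<Rightarrow> real ^ 'p) \<Rightarrow> real \<Rightarrow> real ^ 'p \<Rightarrow> real ^ 'p ^ 'p \<Rightarrow> (nat \<Rightarrow> bool) \<Rightarrow>
   (nat \<Rightarrow> real) \<Rightarrow> real" where
  "evidence n X \<alpha> \<mu> S y \<xi> = enn2real (\<integral>\<^sup>+\<beta>. exp (log_p_tangent n X \<alpha> \<mu> S y \<xi> \<beta>) \<partial>lborel)"

text \<open>Integrating the proportionality against a Gaussian of total mass 1 identifies the
  unknown factor as \<open>evidence\<close>.\<close>

lemma
  fixes S :: "real^'p^'p"
  assumes "0 < \<alpha>" "pos_def S"
  shows evidence_pos: "evidence n X \<alpha> \<mu> S y \<xi> > 0"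
    and exp_log_p_tangent_eq_evidence: "exp (log_p_tangent n X \<alpha> \<mu> S y \<xi> \<beta>) =
      evidence n X \<alpha> \<mu> S y \<xi> * gauss_density (mu_post n X \<alpha> \<mu> S y \<xi>) (post_cov n X \<alpha> S \<xi>) \<beta>"
    and nn_integral_exp_log_p_tangent:
      "(\<integral>\<^sup>+\<beta>. exp (log_p_tangent n X \<alpha> \<mu> S y \<xi> \<beta>) \<partial>lborel) = evidence n X \<alpha> \<mu> S y \<xi>"
proof -
  obtain K where K: "K > 0" "\<And>\<beta>. exp (log_p_tangent n X \<alpha> \<mu> S y \<xi> \<beta>) =
      K * gauss_density (mu_post n X \<alpha> \<mu> S y \<xi>) (post_cov n X \<alpha> S \<xi>) \<beta>"
    using exp_log_p_tangent_proportional[OF assms] by blast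
  have nn: "(\<integral>\<^sup>+\<beta>. exp (log_p_tangent n X \<alpha> \<mu> S y \<xi> \<beta>) \<partial>lborel) = K"
    using K(1) unfolding K(2)
    by (simp add: ennreal_mult' nn_integral_cmult nn_integral_gauss_density pos_def_post_cov[OF assms])
  hence "evidence n X \<alpha> \<mu> S y \<xi> = K" using K(1) by (simp add: evidence_def)
  thus "evidence n X \<alpha> \<mu> S y \<xi> > 0"
    "exp (log_p_tangent n X \<alpha> \<mu> S y \<xi> \<beta>) =
      evidence n X \<alpha> \<mu> S y \<xi> * gauss_density (mu_post n X \<alpha> \<mu> S y \<xi>) (post_cov n X \<alpha> S \<xi>) \<beta>"
    "(\<integral>\<^sup>+\<beta>. exp (log_p_tangent n X \<alpha> \<mu> S y \<xi> \<beta>) \<partial>lborel) = evidence n X \<alpha> \<mu> S y \<xi>"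
    using K nn by simp_all
qed

section \<open>Minimizers of the variational objective\<close>

text \<open>The extended real integral inside \<open>var_objective\<close>, isolated so that it can
  be handled for densities whose integrand has an infinite negative part.\<close>

definition ext_integral :: "('a::euclidean_space \<Rightarrow> real) \<Rightarrow> ereal" where
  "ext_integral f = enn2ereal (\<integral>\<^sup>+x. ennreal (f x) \<partial>lborel) - enn2ereal (\<integral>\<^sup>+x. ennreal (- f x) \<partial>lborel)"

lemma ext_integral_eq_integral:
  assumes f: "integrable lborel f"
  shows "ext_integral f = ereal (integral\<^sup>L lborel f)"
proof -
  have "(\<integral>\<^sup>+x. ennreal (f x) \<partial>lborel) < \<infinity>" "(\<integral>\<^sup>+x. ennreal (- f x) \<partial>lborel) < \<infinity>"
    using f by (auto simp: real_integrable_def less_top)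
  then obtain a b where ab: "(\<integral>\<^sup>+x. ennreal (f x) \<partial>lborel) = ennreal a" "0 \<le> a"
      "(\<integral>\<^sup>+x. ennreal (- f x) \<partial>lborel) = ennreal b" "0 \<le> b"
    by (metis ennreal_cases less_irrefl infinity_ennreal_def)
  thus ?thesis
    unfolding ext_integral_def real_lebesgue_integral_def[OF f] by simp
qed

text \<open>With a finite positive part, an infinite negative part would force the value to be minus
  infinity.\<close>

lemma integrable_of_ext_integral:
  assumes [measurable]: "f \<in> borel_measurable borel"
    and pos: "(\<integral>\<^sup>+x. ennreal (f x) \<partial>lborel) < \<infinity>" and neg: "ext_integral f > - \<infinity>"
  shows "integrable lborel f"
proof -
  have "(\<integral>\<^sup>+x. ennreal (- f x) \<partial>lborel) \<noteq> \<infinity>"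
  proof
    assume inf: "(\<integral>\<^sup>+x. ennreal (- f x) \<partial>lborel) = \<infinity>"
    obtain a where a: "(\<integral>\<^sup>+x. ennreal (f x) \<partial>lborel) = ennreal a" "0 \<le> a"
      using pos by (metis ennreal_cases less_irrefl infinity_ennreal_def)
    show False using neg a by (simp add: ext_integral_def inf)
  qed
  thus ?thesis using pos by (simp add: real_integrable_def)
qed

lemma
  assumes "prob_density g"
  shows integrable_prob_density: "integrable lborel g"
    and integral_prob_density: "integral\<^sup>L lborel g = 1"
proof -
  have "(\<integral>\<^sup>+x. ennreal (g x) \<partial>lborel) = ennreal 1" using assms by (simp add: prob_density_def)
  thus "integrable lborel g" "integral\<^sup>L lborel g = 1" using assms
    by (auto intro!: integrableI_nn_integral_finite[of _ _ 1] integral_eq_nn_integral[THEN trans]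
        simp: prob_density_def)
qed

text \<open>From ln u \<le> u - 1 at u = g/q, with equality only at u = 1. The factor
  \<open>K\<close> carries the unnormalised total mass, so \<open>f\<close> integrates to ln K minus
  the divergence of q from g.\<close>

lemma gibbs:
  fixes g q :: "real^'p \<Rightarrow> real"
  assumes K: "0 < K" and g: "prob_density g" and g_pos: "\<And>x. 0 < g x" and q: "prob_density q"
  defines "f \<equiv> \<lambda>x. ln (K * g x / q x) * q x"
  shows "ext_integral f \<le> ln K" and "ln K \<le> ext_integral f \<Longrightarrow> AE x in lborel. q x = g x"
proof -
  have [measurable]: "g \<in> borel_measurable borel" "q \<in> borel_measurable borel"
    and q0: "0 \<le> q x" for x using g q by (auto simp: prob_density_def)
  have [measurable]: "f \<in> borel_measurable borel" unfolding f_def by measurable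
  \<comment> \<open>The pointwise deficit of ln u \<le> u - 1. It equals
    \<open>q x * (u - 1 - ln u)\<close> where q is positive and \<open>g x\<close> where q vanishes,
    and its integral is ln K minus that of \<open>f\<close>.\<close>
  define r where "r x = g x - q x - (f x - ln K * q x)" for x
  have r: "0 \<le> r x" "r x = 0 \<Longrightarrow> q x = g x" for x
  proof -
    have "0 \<le> r x \<and> (r x = 0 \<longrightarrow> q x = g x)"
    proof (cases "q x = 0")
      case True
      thus ?thesis using g_pos[of x] by (simp add: r_def f_def)
    next
      case False
      hence q1: "0 < q x" using q0[of x] by simp
      hence gq: "0 < g x / q x" using g_pos[of x] by simp
      have "ln (K * g x / q x) = ln K + ln (g x / q x)"
        using ln_mult_pos[OF K gq] by simp
      hence eq: "r x = q x * (g x / q x - 1 - ln (g x / q x))"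
        using q1 by (simp add: r_def f_def field_simps)
      have "0 \<le> r x" unfolding eq using ln_le_minus_one[OF gq] q1 by simp
      moreover have "q x = g x" if "r x = 0"
        using that q1 ln_eq_minus_one[OF gq] unfolding eq by auto
      ultimately show ?thesis by blast
    qed
    thus "0 \<le> r x" "r x = 0 \<Longrightarrow> q x = g x" by auto
  qed
  \<comment> \<open>Domination by the integrable \<open>K * g\<close> keeps the positive part
    finite, so that any value other than minus infinity implies integrability.\<close>
  have f_le: "f x \<le> K * g x" for x
  proof (cases "q x = 0")
    case True
    thus ?thesis using K g_pos[of x] by (simp add: f_def)
  next
    case False
    hence q1: "0 < q x" using q0[of x] by simp
    hence "ln (K * g x / q x) \<le> K * g x / q x - 1"
      using K g_pos[of x] by (intro ln_le_minus_one) simp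
    hence "f x \<le> (K * g x / q x - 1) * q x"
      unfolding f_def using q1 by (intro mult_right_mono) auto
    also have "\<dots> \<le> K * g x" using q1 by (simp add: field_simps)
    finally show ?thesis .
  qed
  have "(\<integral>\<^sup>+x. ennreal (f x) \<partial>lborel) \<le> (\<integral>\<^sup>+x. ennreal K * ennreal (g x) \<partial>lborel)"
    using f_le K by (intro nn_integral_mono) (simp add: ennreal_leI flip: ennreal_mult')
  also have "\<dots> = ennreal K" using g by (simp add: nn_integral_cmult prob_density_def)
  also have "\<dots> < \<infinity>" by simp
  finally have fin: "(\<integral>\<^sup>+x. ennreal (f x) \<partial>lborel) < \<infinity>" .
  have main: "integrable lborel r \<and> ext_integral f = ln K - integral\<^sup>L lborel r" if "ext_integral f \<noteq> - \<infinity>"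
  proof -
    have f: "integrable lborel f" by (rule integrable_of_ext_integral) (use fin that in auto)
    have "integrable lborel r" "integral\<^sup>L lborel r = ln K - integral\<^sup>L lborel f"
      unfolding r_def using f integrable_prob_density[OF g] integrable_prob_density[OF q]
      by (simp_all add: integral_prob_density[OF g] integral_prob_density[OF q])
    thus ?thesis using ext_integral_eq_integral[OF f] by simp
  qed
  show "ext_integral f \<le> ln K"
  proof (cases "ext_integral f = - \<infinity>")
    case False
    have "0 \<le> integral\<^sup>L lborel r" using r by (intro integral_nonneg_AE) auto
    thus ?thesis using main[OF False] by simp
  qed simp
  assume "ln K \<le> ext_integral f"
  with main have "integrable lborel r" "integral\<^sup>L lborel r \<le> 0" by force+
  moreover have "0 \<le> integral\<^sup>L lborel r" using r by (intro integral_nonneg_AE) auto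
  ultimately have "AE x in lborel. r x = 0"
    using integral_nonneg_eq_0_iff_AE[of lborel r] r by auto
  thus "AE x in lborel. q x = g x" by eventually_elim (use r in auto)
qed

lemma ext_integral_self:
  fixes g :: "real^'p \<Rightarrow> real"
  assumes K: "0 < K" and g: "prob_density g" and g_pos: "\<And>x. 0 < g x"
  shows "ext_integral (\<lambda>x. ln (K * g x / g x) * g x) = ln K"
proof -
  have eq: "(\<lambda>x. ln (K * g x / g x) * g x) = (\<lambda>x. ln K * g x)"
    using g_pos by (auto simp: less_imp_neq[THEN not_sym] fun_eq_iff)
  show ?thesis unfolding eq using integrable_prob_density[OF g]
    by (subst ext_integral_eq_integral) (auto simp: integral_prob_density[OF g])
qed

lemma prob_density_gauss_density:
  "pos_def S \<Longrightarrow> prob_density (gauss_density \<mu> S)"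
  by (auto simp: prob_density_def nn_integral_gauss_density intro!: less_imp_le gauss_density_pos)

lemma var_objective_altdef:
  assumes "0 < \<alpha>" "pos_def S"
  shows "var_objective n X \<alpha> \<mu> S y q \<xi> = - ext_integral (\<lambda>\<beta>. ln (evidence n X \<alpha> \<mu> S y \<xi> *
    gauss_density (mu_post n X \<alpha> \<mu> S y \<xi>) (post_cov n X \<alpha> S \<xi>) \<beta> / q \<beta>) * q \<beta>)"
  by (simp add: var_objective_def ext_integral_def Let_def exp_log_p_tangent_eq_evidence[OF assms])

text \<open>Testing the minimizer against the Gaussian belonging to \<xi>' sandwiches its value: ln
  Z(\<xi>') \<le> - objective \<le> ln Z(\<xi>), the second step by Gibbs. At \<xi>' = \<xi> this is
  the equality case.\<close>

theorem
  assumes \<alpha>: "0 < \<alpha>" and S: "pos_def S" and q: "is_minimizer n X \<alpha> \<mu> S y q \<xi>"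
  shows minimizer_AE_gauss_density:
      "AE \<beta> in lborel. q \<beta> = gauss_density (mu_post n X \<alpha> \<mu> S y \<xi>) (post_cov n X \<alpha> S \<xi>) \<beta>"
    and minimizer_evidence_ge: "evidence n X \<alpha> \<mu> S y \<xi>' \<le> evidence n X \<alpha> \<mu> S y \<xi>"
proof -
  let ?g = "\<lambda>\<xi>. gauss_density (mu_post n X \<alpha> \<mu> S y \<xi>) (post_cov n X \<alpha> S \<xi>)"
  let ?K = "evidence n X \<alpha> \<mu> S y"
  have K: "0 < ?K \<xi>" for \<xi> by (rule evidence_pos[OF \<alpha> S])
  have g: "prob_density (?g \<xi>)" and g_pos: "0 < ?g \<xi> \<beta>" for \<xi> \<beta>
    by (intro prob_density_gauss_density gauss_density_pos pos_def_post_cov[OF \<alpha> S])+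
  have self: "var_objective n X \<alpha> \<mu> S y (?g \<xi>') \<xi>' = - ereal (ln (?K \<xi>'))" for \<xi>'
    unfolding var_objective_altdef[OF \<alpha> S] using ext_integral_self[OF K g g_pos] by simp
  have pd: "prob_density q" and
    "var_objective n X \<alpha> \<mu> S y q \<xi> \<le> var_objective n X \<alpha> \<mu> S y (?g \<xi>') \<xi>'" for \<xi>'
    using q g by (auto simp: is_minimizer_def)
  hence le: "ln (?K \<xi>') \<le> ext_integral (\<lambda>\<beta>. ln (?K \<xi> * ?g \<xi> \<beta> / q \<beta>) * q \<beta>)" for \<xi>'
    unfolding self unfolding var_objective_altdef[OF \<alpha> S] by (simp only: ereal_minus_le_minus)
  show "AE \<beta> in lborel. q \<beta> = ?g \<xi> \<beta>"
    by (rule gibbs(2)[OF K g g_pos pd le])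
  have "ereal (ln (?K \<xi>')) \<le> ln (?K \<xi>)"
    using le gibbs(1)[OF K g g_pos pd] by (rule order_trans)
  thus "?K \<xi>' \<le> ?K \<xi>" using K[of \<xi>] K[of \<xi>'] by simp
qed

section \<open>The Renyi risk\<close>

lemma success_prob_eq_exp: "success_prob X \<beta> i = exp (X i \<bullet> \<beta> - ln (1 + exp (X i \<bullet> \<beta>)))"
  and one_minus_success_prob_eq_exp: "1 - success_prob X \<beta> i = exp (- ln (1 + exp (X i \<bullet> \<beta>)))"
  using add_pos_pos[OF zero_less_one exp_gt_zero[of "X i \<bullet> \<beta>"]]
  by (simp_all add: success_prob_def exp_diff exp_minus field_simps)

lemma success_prob_gt_0: "0 < success_prob X \<beta> i"
  by (simp add: success_prob_eq_exp)

lemma success_prob_lt_1: "success_prob X \<beta> i < 1"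
  using one_minus_success_prob_eq_exp[of X \<beta> i] by (metis diff_gt_0_iff_gt exp_gt_zero)

text \<open>The \<alpha>-affinity (Chernoff coefficient) of the two Bernoulli laws of observation
  i.\<close>

definition affinity :: "(nat \<Rightarrow> real ^ 'p) \<Rightarrow> real \<Rightarrow> real ^ 'p \<Rightarrow> real ^ 'p \<Rightarrow> nat \<Rightarrow> real" where
  "affinity X \<alpha> \<beta> \<beta>' i =
     success_prob X \<beta> i powr \<alpha> * success_prob X \<beta>' i powr (1 - \<alpha>) +
     (1 - success_prob X \<beta> i) powr \<alpha> * (1 - success_prob X \<beta>' i) powr (1 - \<alpha>)"

lemma affinity_pos: "0 < affinity X \<alpha> \<beta> \<beta>' i"
  unfolding affinity_def one_minus_success_prob_eq_exp unfolding success_prob_eq_exp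
  by (simp add: add_pos_pos)

text \<open>Weighted arithmetic-geometric mean for each of the two outcomes; the means add up to
  1.\<close>

lemma affinity_le_1:
  assumes "0 \<le> \<alpha>" "\<alpha> \<le> 1"
  shows "affinity X \<alpha> \<beta> \<beta>' i \<le> 1"
proof -
  have "affinity X \<alpha> \<beta> \<beta>' i \<le>
      (\<alpha> * success_prob X \<beta> i + (1 - \<alpha>) * success_prob X \<beta>' i) +
      (\<alpha> * (1 - success_prob X \<beta> i) + (1 - \<alpha>) * (1 - success_prob X \<beta>' i))"
    unfolding affinity_def using assms
    by (intro add_mono Youngs_inequality_0) (auto simp: success_prob_gt_0 success_prob_lt_1)
  also have "\<dots> = 1" by (simp add: algebra_simps)
  finally show ?thesis .
qed

text \<open>Independence factorises the mean. In each factor the ratio to the power \<alpha> is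
  weighted by the true probability, which leaves the true probability to the power 1 -
  \<alpha>.\<close>

lemma expectation_likelihood_ratio_powr:
  "measure_pmf.expectation (logit_pmf n X \<beta>') (\<lambda>y. exp (\<alpha> * (log_lik n X y \<beta> - log_lik n X y \<beta>'))) =
     (\<Prod>i<n. affinity X \<alpha> \<beta> \<beta>' i)"
proof -
  let ?l = "\<lambda>\<beta> i b. of_bool b * (X i \<bullet> \<beta>) - ln (1 + exp (X i \<bullet> \<beta>))"
  let ?r = "\<lambda>i b. exp (\<alpha> * (?l \<beta> i b - ?l \<beta>' i b))"
  have "measure_pmf.expectation (logit_pmf n X \<beta>') (\<lambda>y. exp (\<alpha> * (log_lik n X y \<beta> - log_lik n X y \<beta>'))) =
      measure_pmf.expectation (logit_pmf n X \<beta>') (\<lambda>y. \<Prod>i<n. ?r i (y i))"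
    unfolding log_lik_def sum_subtractf[symmetric] sum_distrib_left exp_sum[OF finite_lessThan] ..
  also have "\<dots> = (\<Prod>i<n. measure_pmf.expectation (bernoulli_pmf (success_prob X \<beta>' i)) (?r i))"
    unfolding logit_pmf_def
    by (subst expectation_prod_Pi_pmf) (auto intro!: integrable_measure_pmf_finite)
  also have "\<dots> = (\<Prod>i<n. affinity X \<alpha> \<beta> \<beta>' i)"
  proof (rule prod.cong[OF refl])
    fix i
    have "measure_pmf.expectation (bernoulli_pmf (success_prob X \<beta>' i)) (?r i) =
        ?r i True * success_prob X \<beta>' i + ?r i False * (1 - success_prob X \<beta>' i)"
      by (rule integral_bernoulli_pmf) (simp_all add: success_prob_gt_0 success_prob_lt_1 less_imp_le)
    also have "\<dots> = affinity X \<alpha> \<beta> \<beta>' i"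
      unfolding affinity_def one_minus_success_prob_eq_exp unfolding success_prob_eq_exp
      by (simp add: powr_def algebra_simps flip: exp_add)
    finally show "measure_pmf.expectation (bernoulli_pmf (success_prob X \<beta>' i)) (?r i) = affinity X \<alpha> \<beta> \<beta>' i" .
  qed
  finally show ?thesis .
qed

text \<open>The function h of the overview. Its exponential is the reciprocal of the mean tempered
  likelihood ratio, which is the normalisation that Markov's inequality needs.\<close>

definition scaled_renyi :: "nat \<Rightarrow> (nat \<Rightarrow> real ^ 'p) \<Rightarrow> real \<Rightarrow> real ^ 'p \<Rightarrow> real ^ 'p \<Rightarrow> real" where
  "scaled_renyi n X \<alpha> \<beta> \<beta>' = - (\<Sum>i<n. ln (affinity X \<alpha> \<beta> \<beta>' i))"

lemma scaled_renyi_eq: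
  assumes "n \<ge> 1" "\<alpha> < 1"
  shows "(1 - \<alpha>) * renyi_div n X \<alpha> \<beta> \<beta>' = scaled_renyi n X \<alpha> \<beta> \<beta>' / n"
proof -
  have "\<alpha> - 1 \<noteq> 0" "real n \<noteq> 0" using assms by auto
  thus ?thesis
    unfolding renyi_div_def scaled_renyi_def affinity_def[symmetric] by (simp add: divide_simps) (simp add: algebra_simps)
qed

lemma scaled_renyi_nonneg:
  "0 \<le> \<alpha> \<Longrightarrow> \<alpha> \<le> 1 \<Longrightarrow> 0 \<le> scaled_renyi n X \<alpha> \<beta> \<beta>'"
  unfolding scaled_renyi_def
  by (simp add: sum_nonpos affinity_pos affinity_le_1)

lemma exp_scaled_renyi: "exp (scaled_renyi n X \<alpha> \<beta> \<beta>') = 1 / (\<Prod>i<n. affinity X \<alpha> \<beta> \<beta>' i)"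
  unfolding scaled_renyi_def exp_minus
  by (subst exp_sum) (simp_all add: affinity_pos inverse_eq_divide)

lemma finite_responses: "finite (responses n)"
  unfolding responses_def by (intro finite_PiE_dflt) auto

lemma set_pmf_logit_pmf: "set_pmf (logit_pmf n X \<beta>) \<subseteq> responses n"
  using set_Pi_pmf_subset[of "{..<n}" False] unfolding logit_pmf_def responses_def PiE_dflt_def
  by fastforce

lemma borel_measurable_success_prob [measurable]:
  "(\<lambda>\<beta>. success_prob X \<beta> i) \<in> borel_measurable borel"
  unfolding success_prob_def by measurable

lemma borel_measurable_scaled_renyi [measurable]:
  "(\<lambda>\<beta>. scaled_renyi n X \<alpha> \<beta> \<beta>') \<in> borel_measurable borel"
  unfolding scaled_renyi_def affinity_def by measurable

lemma borel_measurable_log_lik [measurable]: "log_lik n X y \<in> borel_measurable borel"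
  unfolding log_lik_def[abs_def] by measurable

text \<open>The integrand is normalised so that, for every fixed \<open>\<beta>\<close>, its mean over \<open>y\<close> is the prior density.\<close>

definition renyi_integral ::
  "nat \<Rightarrow> (nat \<Rightarrow> real ^ 'p) \<Rightarrow> real \<Rightarrow> real ^ 'p \<Rightarrow> real ^ 'p ^ 'p \<Rightarrow> real ^ 'p \<Rightarrow> (nat \<Rightarrow> bool) \<Rightarrow> ennreal" where
  "renyi_integral n X \<alpha> \<mu> S \<beta>' y =
     (\<integral>\<^sup>+\<beta>. exp (scaled_renyi n X \<alpha> \<beta> \<beta>' + \<alpha> * (log_lik n X y \<beta> - log_lik n X y \<beta>')) * gauss_density \<mu> S \<beta> \<partial>lborel)"

lemma nn_integral_renyi_integral:
  assumes S: "pos_def S"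
  shows "(\<integral>\<^sup>+y. renyi_integral n X \<alpha> \<mu> S \<beta>' y \<partial>logit_pmf n X \<beta>') = 1"
proof -
  let ?M = "logit_pmf n X \<beta>'" and ?\<pi> = "gauss_density \<mu> S"
  let ?w = "\<lambda>y \<beta>. exp (scaled_renyi n X \<alpha> \<beta> \<beta>' + \<alpha> * (log_lik n X y \<beta> - log_lik n X y \<beta>')) * ?\<pi> \<beta>"
  have fin: "finite (set_pmf ?M)" by (rule finite_subset[OF set_pmf_logit_pmf finite_responses])
  have \<pi>: "0 < ?\<pi> \<beta>" for \<beta> by (rule gauss_density_pos[OF S])
  have "(\<integral>\<^sup>+y. renyi_integral n X \<alpha> \<mu> S \<beta>' y \<partial>?M) =
      (\<Sum>y\<in>set_pmf ?M. renyi_integral n X \<alpha> \<mu> S \<beta>' y * pmf ?M y)"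
    using fin by (rule nn_integral_measure_pmf_finite) simp
  also have "\<dots> = (\<integral>\<^sup>+\<beta>. (\<Sum>y\<in>set_pmf ?M. ennreal (?w y \<beta>) * pmf ?M y) \<partial>lborel)"
    unfolding renyi_integral_def by (subst nn_integral_sum) (simp_all add: nn_integral_multc)
  also have "\<dots> = (\<integral>\<^sup>+\<beta>. ?\<pi> \<beta> \<partial>lborel)"
  proof (rule nn_integral_cong)
    fix \<beta>
    have pos: "0 < (\<Prod>i<n. affinity X \<alpha> \<beta> \<beta>' i)" by (intro prod_pos) (simp add: affinity_pos)
    have "(\<Sum>y\<in>set_pmf ?M. ?w y \<beta> * pmf ?M y) = ?\<pi> \<beta> * exp (scaled_renyi n X \<alpha> \<beta> \<beta>') *
        (\<Sum>y\<in>set_pmf ?M. exp (\<alpha> * (log_lik n X y \<beta> - log_lik n X y \<beta>')) * pmf ?M y)"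
      by (simp add: sum_distrib_left exp_add mult_ac)
    also have "(\<Sum>y\<in>set_pmf ?M. exp (\<alpha> * (log_lik n X y \<beta> - log_lik n X y \<beta>')) * pmf ?M y) =
        (\<Prod>i<n. affinity X \<alpha> \<beta> \<beta>' i)"
      using fin by (subst expectation_likelihood_ratio_powr[symmetric], subst integral_measure_pmf_real[of "set_pmf ?M"]) auto
    \<comment> \<open>\<open>exp (scaled_renyi ...)\<close> is the reciprocal of this product, so
      only the prior density survives.\<close>
    also have "?\<pi> \<beta> * exp (scaled_renyi n X \<alpha> \<beta> \<beta>') * (\<Prod>i<n. affinity X \<alpha> \<beta> \<beta>' i) = ?\<pi> \<beta>"
      using pos unfolding exp_scaled_renyi by (simp del: prod_zero_iff)
    finally have "(\<Sum>y\<in>set_pmf ?M. ?w y \<beta> * pmf ?M y) = ?\<pi> \<beta>" .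
    moreover have "(\<Sum>y\<in>set_pmf ?M. ennreal (?w y \<beta>) * pmf ?M y) = ennreal (\<Sum>y\<in>set_pmf ?M. ?w y \<beta> * pmf ?M y)"
      using \<pi>[of \<beta>] by (subst sum_ennreal[symmetric]) (auto simp: ennreal_mult less_imp_le)
    ultimately show "(\<Sum>y\<in>set_pmf ?M. ennreal (?w y \<beta>) * pmf ?M y) = ennreal (?\<pi> \<beta>)" by simp
  qed
  also have "\<dots> = 1" by (rule nn_integral_gauss_density[OF S])
  finally show ?thesis .
qed

text \<open>The complement of the Markov event, hence the strict inequality. Restriction to
  \<open>responses n\<close>, which carries all the mass, matches the responses for which minimizers
  are available.\<close>

lemma prob_renyi_integral_ge:
  assumes S: "pos_def S" and \<epsilon>: "0 < \<epsilon>"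
  shows "measure_pmf.prob (logit_pmf n X \<beta>') {y \<in> responses n. ennreal \<epsilon> * renyi_integral n X \<alpha> \<mu> S \<beta>' y < 1} \<ge> 1 - \<epsilon>"
proof -
  let ?M = "logit_pmf n X \<beta>'" and ?W = "renyi_integral n X \<alpha> \<mu> S \<beta>'"
  have "emeasure ?M {y \<in> UNIV. 1 \<le> ennreal \<epsilon> * ?W y} \<le> ennreal \<epsilon> * (\<integral>\<^sup>+y. ?W y * indicator UNIV y \<partial>?M)"
    by (rule nn_integral_Markov_inequality) auto
  also have "\<dots> = ennreal \<epsilon>" using nn_integral_renyi_integral[OF S] by simp
  finally have "measure_pmf.prob ?M {y. 1 \<le> ennreal \<epsilon> * ?W y} \<le> \<epsilon>"
    using \<epsilon> by (simp add: measure_pmf.emeasure_eq_measure)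
  moreover have "measure_pmf.prob ?M {y. 1 \<le> ennreal \<epsilon> * ?W y} =
      1 - measure_pmf.prob ?M (UNIV - {y. 1 \<le> ennreal \<epsilon> * ?W y})"
    by (subst measure_pmf.prob_compl[symmetric, of _ ?M, simplified]) (auto intro!: arg_cong2[where f = measure])
  moreover have "measure_pmf.prob ?M (UNIV - {y. 1 \<le> ennreal \<epsilon> * ?W y}) =
      measure_pmf.prob ?M {y \<in> responses n. ennreal \<epsilon> * ?W y < 1}"
    using set_pmf_logit_pmf[of n X \<beta>'] by (intro measure_prob_cong_0) (auto simp: set_pmf_iff not_le)
  ultimately show ?thesis by simp
qed

text \<open>Jensen's inequality, from \<open>1 + (h - ln B) \<le> exp (h - ln B)\<close>.\<close>

lemma integral_le_ln_nn_integral_exp: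
  fixes g h :: "real^'p \<Rightarrow> real"
  assumes g: "prob_density g" and [measurable]: "h \<in> borel_measurable borel" and h: "\<And>x. 0 \<le> h x"
    and B: "0 < B" and le: "(\<integral>\<^sup>+x. exp (h x) * g x \<partial>lborel) \<le> ennreal B"
  shows "(\<integral>x. h x * g x \<partial>lborel) \<le> ln B"
proof -
  have [measurable]: "g \<in> borel_measurable borel" and g0: "0 \<le> g x" for x
    using g by (auto simp: prob_density_def)
  note int_g = integrable_prob_density[OF g] integral_prob_density[OF g]
  have int_e: "integrable lborel (\<lambda>x. exp (h x) * g x)"
    using le by (intro integrableI_bounded) (auto simp: g0 intro: le_less_trans)
  have "(\<integral>x. exp (h x) * g x \<partial>lborel) \<le> B"
    using le B by (subst integral_eq_nn_integral) (auto simp: g0 intro: enn2real_leI)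
  \<comment> \<open>Nonnegativity of h gives domination by exp h, so the Bochner integral of
    \<open>h x * g x\<close> is not a default value.\<close>
  have int_h: "integrable lborel (\<lambda>x. h x * g x)"
  proof (rule Bochner_Integration.integrable_bound[OF int_e])
    have "h x \<le> exp (h x)" for x using exp_ge_add_one_self[of "h x"] by linarith
    thus "AE x in lborel. norm (h x * g x) \<le> norm (exp (h x) * g x)"
      using h by (auto simp: abs_mult intro!: mult_right_mono)
  qed measurable
  have "(\<integral>x. h x * g x \<partial>lborel) + (1 - ln B) = (\<integral>x. h x * g x + (1 - ln B) * g x \<partial>lborel)"
    using int_h int_g by simp
  also have "\<dots> \<le> (\<integral>x. (1 / B) * (exp (h x) * g x) \<partial>lborel)"
  proof (intro integral_mono)
    fix x
    have "h x + (1 - ln B) \<le> exp (h x - ln B)" using exp_ge_add_one_self[of "h x - ln B"] by linarith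
    also have "\<dots> = (1 / B) * exp (h x)" using B by (simp add: exp_diff)
    finally have "(h x + (1 - ln B)) * g x \<le> ((1 / B) * exp (h x)) * g x"
      by (rule mult_right_mono) (rule g0)
    thus "h x * g x + (1 - ln B) * g x \<le> (1 / B) * (exp (h x) * g x)"
      by (simp add: algebra_simps)
  qed (use int_h int_g int_e in auto)
  also have "\<dots> = (1 / B) * (\<integral>x. exp (h x) * g x \<partial>lborel)" by (rule integral_mult_right_zero)
  also have "\<dots> \<le> 1"
    using \<open>(\<integral>x. exp (h x) * g x \<partial>lborel) \<le> B\<close> B by (simp add: field_simps)
  finally show ?thesis by simp
qed

text \<open>The Gaussian is the tempered minorant times the prior over Z(\<xi>). Replacing the
  minorant by the log-likelihood removes \<xi> everywhere except in Z(\<xi>), so the hypothesis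
  \<open>W\<close>, free of \<xi>, serves all \<xi> at once.\<close>

lemma renyi_risk_le_evidence:
  fixes S :: "real^'p^'p"
  assumes \<alpha>: "0 < \<alpha>" "\<alpha> < 1" and S: "pos_def S" and \<epsilon>: "0 < \<epsilon>"
    and W: "ennreal \<epsilon> * renyi_integral n X \<alpha> \<mu> S \<beta>' y < 1"
  shows "(\<integral>\<beta>. scaled_renyi n X \<alpha> \<beta> \<beta>' * gauss_density (mu_post n X \<alpha> \<mu> S y \<xi>) (post_cov n X \<alpha> S \<xi>) \<beta> \<partial>lborel)
    \<le> ln (1 / \<epsilon>) + \<alpha> * log_lik n X y \<beta>' - ln (evidence n X \<alpha> \<mu> S y \<xi>)"
proof -
  let ?g = "gauss_density (mu_post n X \<alpha> \<mu> S y \<xi>) (post_cov n X \<alpha> S \<xi>)" and ?Z = "evidence n X \<alpha> \<mu> S y \<xi>"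
  let ?h = "\<lambda>\<beta>. scaled_renyi n X \<alpha> \<beta> \<beta>'"
  let ?L = "exp (\<alpha> * log_lik n X y \<beta>')"
  note Z = evidence_pos[OF \<alpha>(1) S, of n X \<mu> y \<xi>]
  have W': "renyi_integral n X \<alpha> \<mu> S \<beta>' y \<le> ennreal (1 / \<epsilon>)"
  proof (cases "renyi_integral n X \<alpha> \<mu> S \<beta>' y")
    case (real r)
    hence "\<epsilon> * r < 1" using W \<epsilon> by (simp add: ennreal_less_iff flip: ennreal_mult ennreal_1)
    thus ?thesis using real \<epsilon> by (auto intro!: ennreal_leI simp: field_simps)
  next
    case top
    thus ?thesis using W \<epsilon> by (simp add: ennreal_mult_top)
  qed
  have "(\<integral>\<^sup>+\<beta>. exp (?h \<beta>) * ?g \<beta> \<partial>lborel) \<le>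
      (\<integral>\<^sup>+\<beta>. ennreal (?L / ?Z) * (exp (?h \<beta> + \<alpha> * (log_lik n X y \<beta> - log_lik n X y \<beta>')) * gauss_density \<mu> S \<beta>) \<partial>lborel)"
  proof (rule nn_integral_mono)
    fix \<beta>
    have \<pi>: "0 < gauss_density \<mu> S \<beta>" by (rule gauss_density_pos[OF S])
    have "?g \<beta> = exp (\<alpha> * tangent_log_lik n X y \<xi> \<beta>) * gauss_density \<mu> S \<beta> / ?Z"
      using exp_log_p_tangent_eq_evidence[OF \<alpha>(1) S, of n X \<mu> y \<xi> \<beta>] exp_log_p_tangent[OF S, of n X \<alpha> \<mu> y \<xi> \<beta>] Z
      by (simp add: field_simps)
    also have "\<dots> \<le> exp (\<alpha> * log_lik n X y \<beta>) * gauss_density \<mu> S \<beta> / ?Z"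
      using \<alpha> \<pi> Z tangent_log_lik_le[of n X y \<xi> \<beta>] by (intro divide_right_mono mult_right_mono) auto
    finally have "exp (?h \<beta>) * ?g \<beta> \<le> exp (?h \<beta>) * (exp (\<alpha> * log_lik n X y \<beta>) * gauss_density \<mu> S \<beta> / ?Z)"
      by (rule mult_left_mono) simp
    also have "\<dots> = ?L / ?Z * (exp (?h \<beta> + \<alpha> * (log_lik n X y \<beta> - log_lik n X y \<beta>')) * gauss_density \<mu> S \<beta>)"
      by (simp add: exp_add exp_diff right_diff_distrib)
    finally show "ennreal (exp (?h \<beta>) * ?g \<beta>) \<le>
        ennreal (?L / ?Z) * ennreal (exp (?h \<beta> + \<alpha> * (log_lik n X y \<beta> - log_lik n X y \<beta>')) * gauss_density \<mu> S \<beta>)"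
      using \<pi> Z by (subst ennreal_mult[symmetric]) (auto intro!: ennreal_leI)
  qed
  also have "\<dots> = ennreal (?L / ?Z) * renyi_integral n X \<alpha> \<mu> S \<beta>' y"
    unfolding renyi_integral_def by (rule nn_integral_cmult) measurable
  also have "\<dots> \<le> ennreal (?L / ?Z) * ennreal (1 / \<epsilon>)"
    using W' by (rule mult_left_mono) simp
  also have "\<dots> = ennreal (?L / ?Z * (1 / \<epsilon>))"
    using Z \<epsilon> by (intro ennreal_mult[symmetric]) auto
  finally have "(\<integral>\<beta>. ?h \<beta> * ?g \<beta> \<partial>lborel) \<le> ln (?L / ?Z * (1 / \<epsilon>))"
    using \<alpha> Z \<epsilon>
    by (intro integral_le_ln_nn_integral_exp prob_density_gauss_density pos_def_post_cov S)
      (auto simp: scaled_renyi_nonneg)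
  also have "ln (?L / ?Z * (1 / \<epsilon>)) = ln (1 / \<epsilon>) + \<alpha> * log_lik n X y \<beta>' - ln ?Z"
    using Z \<epsilon> by (simp add: ln_mult_pos ln_div)
  finally show ?thesis .
qed

section \<open>Lower bound for the evidence at the tangency point\<close>

lemma pos_def_scaled_mat_1: "0 < \<kappa> \<Longrightarrow> pos_def (\<kappa> *\<^sub>R mat 1 :: real^'p^'p)"
  by (simp add: pos_def_def transpose_scalar scaleR_matrix_vector_assoc[symmetric])

lemma det_scaled_mat_1: "det (\<kappa> *\<^sub>R mat 1 :: real^'p^'p) = \<kappa> ^ CARD('p)"
  by (subst det_diagonal) (simp_all add: mat_def)

text \<open>Recentring at b/\<kappa> removes the linear term and leaves a factor exp (b \<bullet> b
  / (2 \<kappa>)), at least 1, which is dropped. A tilt can only increase the integral, so no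
  control of \<open>b\<close> is required.\<close>

lemma nn_integral_gaussian_tilted_ge:
  fixes b :: "real^'p"
  assumes \<kappa>: "0 < \<kappa>"
  shows "(\<integral>\<^sup>+v. exp (b \<bullet> v - \<kappa> / 2 * (v \<bullet> v)) \<partial>lborel) \<ge> sqrt ((2 * pi) ^ CARD('p) / \<kappa> ^ CARD('p))"
proof -
  let ?e = "\<lambda>v::real^'p. exp (b \<bullet> v - \<kappa> / 2 * (v \<bullet> v))"
  let ?k = "\<lambda>v::real^'p. exp (- (v \<bullet> ((\<kappa> *\<^sub>R mat 1) *v v)) / 2)"
  have "ennreal (sqrt ((2 * pi) ^ CARD('p) / \<kappa> ^ CARD('p))) = (\<integral>\<^sup>+v. ?k v \<partial>lborel)"
    unfolding nn_integral_gaussian[OF pos_def_scaled_mat_1[OF \<kappa>]] det_scaled_mat_1 ..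
  also have "\<dots> \<le> (\<integral>\<^sup>+v. ?e ((1 / \<kappa>) *\<^sub>R b + v) \<partial>lborel)"
  proof (intro nn_integral_mono ennreal_leI, subst exp_le_cancel_iff)
    fix v :: "real^'p"
    have "b \<bullet> ((1 / \<kappa>) *\<^sub>R b + v) - \<kappa> / 2 * (((1 / \<kappa>) *\<^sub>R b + v) \<bullet> ((1 / \<kappa>) *\<^sub>R b + v)) =
        (b \<bullet> b) / (2 * \<kappa>) - \<kappa> / 2 * (v \<bullet> v)"
      using \<kappa> by (simp add: inner_add_left inner_add_right inner_commute field_simps power2_eq_square)
    moreover have "0 \<le> (b \<bullet> b) / (2 * \<kappa>)" using \<kappa> by simp
    ultimately show "- (v \<bullet> ((\<kappa> *\<^sub>R mat 1) *v v)) / 2 \<le>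
        b \<bullet> ((1 / \<kappa>) *\<^sub>R b + v) - \<kappa> / 2 * (((1 / \<kappa>) *\<^sub>R b + v) \<bullet> ((1 / \<kappa>) *\<^sub>R b + v))"
      by (simp add: scaleR_matrix_vector_assoc[symmetric])
  qed
  also have "\<dots> = (\<integral>\<^sup>+v. ?e v \<partial>lborel)"
    by (rule nn_integral_lborel_translate) measurable
  finally show ?thesis .
qed

text \<open>Expand the exponent around \<beta>': its value there contains the true log-likelihood by
  tangency, its gradient is discarded as a tilt, and its curvature is bounded by an isotropic
  \<kappa>, which makes the remaining integral explicit.\<close>

lemma evidence_ge:
  fixes S :: "real^'p^'p"
  assumes \<alpha>: "0 < \<alpha>" and S: "pos_def S" and R: "\<And>i. i < n \<Longrightarrow> norm (X i) \<le> R"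
    and n: "n \<ge> 1" and \<rho>: "0 < \<rho>" "\<And>v. v \<bullet> (matrix_inv S *v v) \<le> \<rho> * (v \<bullet> v)"
  defines "\<kappa> \<equiv> \<rho> + \<alpha> * n * R\<^sup>2 / 4"
  shows "ln (evidence n X \<alpha> \<mu> S y (\<lambda>i. X i \<bullet> \<beta>')) \<ge>
    \<alpha> * log_lik n X y \<beta>' - n * C_const n \<beta>' \<mu> S - ln (det S) / 2 - CARD('p) / 2 * ln \<kappa>"
proof -
  let ?\<xi> = "\<lambda>i. X i \<bullet> \<beta>'" and ?d = "\<beta>' - \<mu>"
  let ?A = "XtAX n X ?\<xi>" and ?M = "matrix_inv S"
  note Mi = pos_def_matrix_inv[OF S]
  have \<kappa>: "0 < \<kappa>" using \<alpha> \<rho> n by (simp add: \<kappa>_def add_pos_nonneg)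
  \<comment> \<open>The gradient of the exponent at \<beta>'. Besides the log-likelihood, it is the
    only place where y enters the expansion.\<close>
  define b where "b = \<alpha> *\<^sub>R (Xt_centred n X y + 2 *\<^sub>R (?A *v \<beta>')) - ?M *v ?d"
  \<comment> \<open>The unnormalised posterior at \<beta>' itself; its power of 2 pi cancels against
    the one in \<open>?J\<close>.\<close>
  define c where "c = exp (\<alpha> * log_lik n X y \<beta>' - n * C_const n \<beta>' \<mu> S) / sqrt ((2 * pi) ^ CARD('p) * det S)"
  have detS: "0 < det S" by (rule det_pos_def[OF S])
  have c: "0 < c" using detS by (simp add: c_def)
  have nC: "n * C_const n \<beta>' \<mu> S = (?d \<bullet> (?M *v ?d)) / 2"
    using n by (simp add: C_const_def)
  have A_sym: "\<beta>' \<bullet> (?A *v v) = v \<bullet> (?A *v \<beta>')" for v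
    by (simp add: inner_XtAX mult_ac)
  have lower: "c * exp (b \<bullet> v - \<kappa> / 2 * (v \<bullet> v)) \<le> exp (log_p_tangent n X \<alpha> \<mu> S y ?\<xi> (\<beta>' + v))" for v
  proof -
    have 1: "tangent_log_lik n X y ?\<xi> (\<beta>' + v) =
        log_lik n X y \<beta>' + (Xt_centred n X y + 2 *\<^sub>R (?A *v \<beta>')) \<bullet> v + v \<bullet> (?A *v v)"
      unfolding tangent_log_lik_eq[symmetric] tangent_log_lik_def
      by (simp add: inner_add_left inner_add_right matrix_vector_right_distrib A_sym[of v]
          inner_commute[of "?A *v \<beta>'" v])
    have 2: "(\<beta>' + v - \<mu>) \<bullet> (?M *v (\<beta>' + v - \<mu>)) =
        ?d \<bullet> (?M *v ?d) + 2 * ((?M *v ?d) \<bullet> v) + v \<bullet> (?M *v v)"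
    proof -
      have eq: "\<beta>' + v - \<mu> = ?d + v" by simp
      show ?thesis
        unfolding eq using inner_pos_def_commute[OF Mi, of ?d v]
        by (simp add: inner_add_left inner_add_right matrix_vector_right_distrib inner_commute)
    qed
    \<comment> \<open>Curvature of the minorant: each coefficient is at most 1/8, and Cauchy-Schwarz
      bounds each squared inner product by R^2 (v \<bullet> v).\<close>
    have "- (v \<bullet> (?A *v v)) = (\<Sum>i<n. - A_fun (?\<xi> i) * (X i \<bullet> v)\<^sup>2)"
      by (simp add: inner_XtAX sum_negf power2_eq_square mult.assoc)
    also have "\<dots> \<le> (\<Sum>i<n. 1 / 8 * (R\<^sup>2 * (v \<bullet> v)))"
    proof (rule sum_mono)
      fix i assume "i \<in> {..<n}"
      hence "norm (X i) \<le> R" using R by simp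
      have "(X i \<bullet> v)\<^sup>2 \<le> (X i \<bullet> X i) * (v \<bullet> v)" by (rule Cauchy_Schwarz_ineq)
      also have "\<dots> \<le> R\<^sup>2 * (v \<bullet> v)"
        using \<open>norm (X i) \<le> R\<close> by (intro mult_right_mono) (simp_all add: dot_square_norm power_mono)
      finally show "- A_fun (?\<xi> i) * (X i \<bullet> v)\<^sup>2 \<le> 1 / 8 * (R\<^sup>2 * (v \<bullet> v))"
        using A_fun_ge[of "?\<xi> i"] by (intro mult_mono) auto
    qed
    also have "\<dots> = n * R\<^sup>2 / 8 * (v \<bullet> v)" by simp
    finally have "\<alpha> * - (v \<bullet> (?A *v v)) \<le> \<alpha> * (n * R\<^sup>2 / 8 * (v \<bullet> v))"
      using \<alpha> by (intro mult_left_mono) auto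
    with \<rho>(2)[of v] have 3: "v \<bullet> (?M *v v) / 2 - \<alpha> * (v \<bullet> (?A *v v)) \<le> \<kappa> / 2 * (v \<bullet> v)"
      by (simp add: \<kappa>_def algebra_simps)
    have bv: "b \<bullet> v = \<alpha> * ((Xt_centred n X y + 2 *\<^sub>R (?A *v \<beta>')) \<bullet> v) - (?M *v ?d) \<bullet> v"
      by (simp only: b_def inner_diff_left inner_scaleR_left)
    have "\<alpha> * log_lik n X y \<beta>' - n * C_const n \<beta>' \<mu> S + (b \<bullet> v - \<kappa> / 2 * (v \<bullet> v)) \<le>
        \<alpha> * tangent_log_lik n X y ?\<xi> (\<beta>' + v) - ((\<beta>' + v - \<mu>) \<bullet> (?M *v (\<beta>' + v - \<mu>))) / 2"
      unfolding 1 2 nC bv distrib_left add_divide_distrib using 3 by linarith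
    hence "exp (\<alpha> * log_lik n X y \<beta>' - n * C_const n \<beta>' \<mu> S) * exp (b \<bullet> v - \<kappa> / 2 * (v \<bullet> v)) \<le>
        exp (\<alpha> * tangent_log_lik n X y ?\<xi> (\<beta>' + v)) * exp (- ((\<beta>' + v - \<mu>) \<bullet> (?M *v (\<beta>' + v - \<mu>))) / 2)"
      unfolding exp_add[symmetric] by simp
    thus ?thesis
      unfolding exp_log_p_tangent[OF S] gauss_density_def c_def
      using detS by (simp add: divide_right_mono)
  qed
  let ?J = "sqrt ((2 * pi) ^ CARD('p) / \<kappa> ^ CARD('p))"
  have "ennreal (c * ?J) = ennreal c * ennreal ?J" using c by (simp add: ennreal_mult')
  also have "\<dots> \<le> ennreal c * (\<integral>\<^sup>+v. exp (b \<bullet> v - \<kappa> / 2 * (v \<bullet> v)) \<partial>lborel)"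
    using nn_integral_gaussian_tilted_ge[OF \<kappa>] by (rule mult_left_mono) simp
  also have "\<dots> = (\<integral>\<^sup>+v. c * exp (b \<bullet> v - \<kappa> / 2 * (v \<bullet> v)) \<partial>lborel)"
    using c by (simp add: nn_integral_cmult ennreal_mult')
  also have "\<dots> \<le> (\<integral>\<^sup>+v. exp (log_p_tangent n X \<alpha> \<mu> S y ?\<xi> (\<beta>' + v)) \<partial>lborel)"
    by (intro nn_integral_mono ennreal_leI lower)
  also have "\<dots> = (\<integral>\<^sup>+v. exp (log_p_tangent n X \<alpha> \<mu> S y ?\<xi> v) \<partial>lborel)"
    unfolding exp_log_p_tangent_eq_evidence[OF \<alpha> S]
    by (rule nn_integral_lborel_translate) measurable
  also have "\<dots> = evidence n X \<alpha> \<mu> S y ?\<xi>" by (rule nn_integral_exp_log_p_tangent[OF \<alpha> S])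
  finally have le: "c * ?J \<le> evidence n X \<alpha> \<mu> S y ?\<xi>"
    using evidence_pos[OF \<alpha> S, of n X \<mu> y ?\<xi>] by (simp add: ennreal_le_iff)
  have "0 < c * ?J" using c \<kappa> by simp
  with le have "ln (c * ?J) \<le> ln (evidence n X \<alpha> \<mu> S y ?\<xi>)" by simp
  moreover have "ln (c * ?J) = \<alpha> * log_lik n X y \<beta>' - n * C_const n \<beta>' \<mu> S - ln (det S) / 2 - CARD('p) / 2 * ln \<kappa>"
    using detS \<kappa> c
    by (simp add: c_def ln_mult_pos ln_div ln_sqrt ln_realpow field_simps)
  ultimately show ?thesis by simp
qed

text \<open>The operator norm plus 1, where the summand secures strict positivity.\<close>

lemma pos_def_inner_bound:
  fixes M :: "real^'p^'p"
  shows "\<exists>\<rho>>0. \<forall>v. v \<bullet> (M *v v) \<le> \<rho> * (v \<bullet> v)"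
proof (intro exI conjI allI)
  let ?K = "onorm ((*v) M)"
  have bl: "bounded_linear ((*v) M)" by (rule matrix_vector_mul_bounded_linear)
  show "0 < ?K + 1" using onorm_pos_le[OF bl] by simp
  fix v :: "real^'p"
  have "v \<bullet> (M *v v) \<le> norm v * norm (M *v v)" by (rule norm_cauchy_schwarz)
  also have "\<dots> \<le> norm v * (?K * norm v)" by (intro mult_left_mono onorm bl) auto
  also have "\<dots> \<le> (?K + 1) * (v \<bullet> v)"
    by (simp add: dot_square_norm power2_eq_square algebra_simps)
  finally show "v \<bullet> (M *v v) \<le> (?K + 1) * (v \<bullet> v)" .
qed

lemma norm_le_norm_2_inf: "i < n \<Longrightarrow> norm (X i) \<le> norm_2_inf n X"
  unfolding norm_2_inf_def by (intro Max_ge) auto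

lemma norm_2_inf_nonneg: "n \<ge> 1 \<Longrightarrow> 0 \<le> norm_2_inf n X"
  using norm_le_norm_2_inf[of 0 n X] norm_ge_zero[of "X 0"] by linarith

lemma C_const_nonneg:
  assumes "pos_def S"
  shows "0 \<le> C_const n \<beta> \<mu> S"
proof -
  have "0 \<le> (\<beta> - \<mu>) \<bullet> (matrix_inv S *v (\<beta> - \<mu>))"
    using pos_def_matrix_inv[OF assms] by (cases "\<beta> = \<mu>") (auto simp: pos_def_def less_imp_le)
  thus ?thesis by (simp add: C_const_def)
qed

text \<open>All success probabilities are 1/2 whatever the coefficient, so every affinity is 1. This
  settles R = 0, where \<open>L_const\<close> degenerates.\<close>

lemma renyi_div_zero_design:
  assumes "\<And>i. i < n \<Longrightarrow> X i = 0"
  shows "renyi_div n X \<alpha> \<beta> \<beta>' = 0"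
  using assms by (simp add: renyi_div_def success_prob_def flip: powr_add)

text \<open>Supplies the threshold from which \<open>D\<close> is built; \<open>M\<close> \<ge> 1
  keeps its square root positive.\<close>

lemma eventually_linear_dominates_ln:
  fixes K c \<alpha> :: real
  assumes "0 < \<alpha>"
  shows "\<exists>M\<ge>1. \<forall>N\<ge>M. K + c * ln N \<le> \<alpha> * N"
proof -
  have "eventually (\<lambda>N. K + c * ln N \<le> \<alpha> * N) at_top"
    using assms by real_asymp
  then obtain M where "\<And>N. N \<ge> M \<Longrightarrow> K + c * ln N \<le> \<alpha> * N"
    by (auto simp: eventually_at_top_linorder)
  thus ?thesis by (intro exI[of _ "max 1 M"]) auto
qed

text \<open>\<open>R\<close> is fixed before \<open>D\<close>; the sample size, design, truth, prior
  mean and minimizers come after it, so \<open>D\<close> depends only on \<alpha>, p, R and the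
  prior covariance. The minimizers are functions of y because they depend on the data.\<close>

theorem theorem3p1:
  fixes \<alpha> R :: real and S\<^sub>\<beta> :: "real ^ 'p ^ 'p"
  assumes "0 < \<alpha>" and "\<alpha> < 1" and "pos_def S\<^sub>\<beta>"
  shows "\<exists>D>0. \<forall>(n::nat) (X :: nat \<Rightarrow> real ^ 'p) (\<beta>s :: real ^ 'p) (\<mu>\<^sub>\<beta> :: real ^ 'p)
      (qs :: (nat \<Rightarrow> bool) \<Rightarrow> real ^ 'p \<Rightarrow> real) (\<xi>s :: (nat \<Rightarrow> bool) \<Rightarrow> nat \<Rightarrow> real).
    n \<ge> 1 \<longrightarrow> norm_2_inf n X = R \<longrightarrow>
    (\<forall>y \<in> responses n. is_minimizer n X \<alpha> \<mu>\<^sub>\<beta> S\<^sub>\<beta> y (qs y) (\<xi>s y)) \<longrightarrow>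
    (\<forall>y \<in> responses n. AE \<beta> in lborel.
       qs y \<beta> = gauss_density (mu_post n X \<alpha> \<mu>\<^sub>\<beta> S\<^sub>\<beta> y (\<xi>s y))
                  ((1 / \<alpha>) *\<^sub>R Sigma_post n X \<alpha> S\<^sub>\<beta> (\<xi>s y)) \<beta>) \<and>
    (\<forall>\<epsilon>::real. 0 < \<epsilon> \<and> \<epsilon> < 1 \<longrightarrow>
       measure_pmf.prob (logit_pmf n X \<beta>s)
         {y. (1 - \<alpha>) * (\<integral>\<beta>. renyi_div n X \<alpha> \<beta> \<beta>s *
                 gauss_density (mu_post n X \<alpha> \<mu>\<^sub>\<beta> S\<^sub>\<beta> y (\<xi>s y))
                   ((1 / \<alpha>) *\<^sub>R Sigma_post n X \<alpha> S\<^sub>\<beta> (\<xi>s y)) \<beta> \<partial>lborel)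
             \<le> D * \<alpha> * \<epsilon>\<^sup>2 + real CARD('p) / real n * ln (L_const n X \<beta>s / \<epsilon>\<^sup>2)
                + C_const n \<beta>s \<mu>\<^sub>\<beta> S\<^sub>\<beta> + 1 / real n * ln (1 / \<epsilon>)}
       \<ge> (1 - \<epsilon>) - 1 / ((D - 1)\<^sup>2 * real n * \<epsilon>\<^sup>2))"
proof -
  let ?S = "S\<^sub>\<beta>" and ?p = "real CARD('p)"
  note \<alpha> = \<open>0 < \<alpha>\<close> and S = \<open>pos_def S\<^sub>\<beta>\<close>
  obtain \<rho> where \<rho>: "0 < \<rho>" "\<And>v. v \<bullet> (matrix_inv ?S *v v) \<le> \<rho> * (v \<bullet> v)"
    using pos_def_inner_bound[of "matrix_inv ?S"] by blast
  \<comment> \<open>The isotropic precision for n = 1; for n \<ge> 1 the precision in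
    \<open>evidence_ge\<close> is at most n times this value.\<close>
  define \<kappa> where "\<kappa> = \<rho> + \<alpha> * R\<^sup>2 / 4"
  \<comment> \<open>Everything in the comparison that depends on neither n nor \<epsilon>; the last
    term is the share of \<open>L_const\<close> that is used, through its lower bound 4 R.\<close>
  define K where "K = ln (det ?S) / 2 + ?p / 2 * ln \<kappa> - ?p * ln (4 * R)"
  obtain M where M: "M \<ge> 1" "\<And>N. N \<ge> M \<Longrightarrow> K + ?p / 2 * ln N \<le> \<alpha> * N"
    using eventually_linear_dominates_ln[OF \<alpha>] by blast
  \<comment> \<open>With \<open>D\<close> this close to 1 the assertion is vacuous unless \<open>n \<epsilon>\<^sup>2 \<ge> M\<close>, and then
    \<open>\<alpha> n \<epsilon>\<^sup>2\<close> absorbs all constants and the logarithm of \<open>n \<epsilon>\<^sup>2\<close>.\<close>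
  define D where "D = 1 + 1 / sqrt M"
  have D: "1 < D" and D1: "(D - 1)\<^sup>2 = 1 / M"
    using M(1) by (simp_all add: D_def power_divide)
  have \<kappa>: "0 < \<kappa>" using \<rho>(1) \<alpha> by (simp add: \<kappa>_def add_pos_nonneg)
  show ?thesis
  proof (intro exI[of _ D] conjI allI impI ballI; (elim conjE)?)
    show "0 < D" using D by simp
  next
    fix n :: nat and X :: "nat \<Rightarrow> real ^ 'p" and \<beta>s \<mu> :: "real ^ 'p" and qs \<xi>s y
    assume "\<forall>y\<in>responses n. is_minimizer n X \<alpha> \<mu> ?S y (qs y) (\<xi>s y)" "y \<in> responses n"
    thus "AE \<beta> in lborel. qs y \<beta> = gauss_density (mu_post n X \<alpha> \<mu> ?S y (\<xi>s y))
        ((1 / \<alpha>) *\<^sub>R Sigma_post n X \<alpha> ?S (\<xi>s y)) \<beta>"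
      using minimizer_AE_gauss_density[OF \<alpha> S] by (auto simp: post_cov_def)
  next
    fix n :: nat and X :: "nat \<Rightarrow> real ^ 'p" and \<beta>s \<mu> :: "real ^ 'p" and \<epsilon> :: real
      and qs :: "(nat \<Rightarrow> bool) \<Rightarrow> real ^ 'p \<Rightarrow> real" and \<xi>s :: "(nat \<Rightarrow> bool) \<Rightarrow> nat \<Rightarrow> real"
    assume n: "n \<ge> 1" and R: "norm_2_inf n X = R" and \<epsilon>: "0 < \<epsilon>" "\<epsilon> < 1"
      and min: "\<forall>y\<in>responses n. is_minimizer n X \<alpha> \<mu> ?S y (qs y) (\<xi>s y)"
    let ?g = "\<lambda>y. gauss_density (mu_post n X \<alpha> \<mu> ?S y (\<xi>s y)) (post_cov n X \<alpha> ?S (\<xi>s y))"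
    let ?L = "L_const n X \<beta>s" and ?C = "C_const n \<beta>s \<mu> ?S"
    let ?rhs = "D * \<alpha> * \<epsilon>\<^sup>2 + ?p / real n * ln (?L / \<epsilon>\<^sup>2) + ?C + 1 / real n * ln (1 / \<epsilon>)"
    let ?E = "{y. (1 - \<alpha>) * (\<integral>\<beta>. renyi_div n X \<alpha> \<beta> \<beta>s * ?g y \<beta> \<partial>lborel) \<le> ?rhs}"
    let ?P = "measure_pmf.prob (logit_pmf n X \<beta>s)"
    have R0: "0 \<le> R" using norm_2_inf_nonneg[OF n, of X] R by simp
    have Xi: "norm (X i) \<le> R" if "i < n" for i using norm_le_norm_2_inf[OF that] R by auto
    have tail: "0 \<le> 1 / ((D - 1)\<^sup>2 * real n * \<epsilon>\<^sup>2)" by simp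
    have n0: "0 < real n" using n by simp
    consider "R = 0" | "real n * \<epsilon>\<^sup>2 < M" | "0 < R" "M \<le> real n * \<epsilon>\<^sup>2" using R0 by linarith
    hence "(1 - \<epsilon>) - 1 / ((D - 1)\<^sup>2 * real n * \<epsilon>\<^sup>2) \<le> ?P ?E"
    proof cases
      case 1
      \<comment> \<open>here \<open>L_const\<close> is 0, and \<open>ln 0 = 0\<close>\<close>
      hence X0: "X i = 0" if "i < n" for i using Xi[OF that] by simp
      have "?L = 0" using 1 R by (simp add: L_const_def)
      moreover have "0 \<le> D * \<alpha> * \<epsilon>\<^sup>2" using D \<alpha> by simp
      moreover have "0 \<le> 1 / real n * ln (1 / \<epsilon>)" using \<epsilon> by (intro mult_nonneg_nonneg) auto
      ultimately have "0 \<le> ?rhs" using C_const_nonneg[OF S, of n \<beta>s \<mu>] by simp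
      hence "?E = UNIV" using X0 by (simp add: renyi_div_zero_design)
      hence "?P ?E = 1" by simp
      thus ?thesis using tail \<epsilon> by linarith
    next
      case 2
      \<comment> \<open>the asserted lower bound on the probability is nonpositive\<close>
      have "1 \<le> M / (real n * \<epsilon>\<^sup>2)" using 2 n0 \<epsilon> by (simp add: field_simps)
      hence "(1 - \<epsilon>) - 1 / ((D - 1)\<^sup>2 * real n * \<epsilon>\<^sup>2) \<le> 0"
        unfolding D1 using \<epsilon> by (simp add: field_simps)
      also have "0 \<le> ?P ?E" by simp
      finally show ?thesis .
    next
      case 3
      let ?G = "{y \<in> responses n. ennreal \<epsilon> * renyi_integral n X \<alpha> \<mu> ?S \<beta>s y < 1}"
      have L: "4 * R \<le> ?L" using R by (simp add: L_const_def)
      define N where "N = real n * \<epsilon>\<^sup>2"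
      have N: "M \<le> N" "0 < N" using 3 n0 \<epsilon> by (simp_all add: N_def)
      \<comment> \<open>Writing n as N/\<epsilon>^2 splits (p/2) ln n. The part in 1/\<epsilon>^2 is
        covered by p ln (L/\<epsilon>^2) with half to spare, and the part in N is absorbed by
        \<alpha> N above the threshold.\<close>
      have arith: "ln (det ?S) / 2 + ?p / 2 * ln (\<rho> + \<alpha> * n * R\<^sup>2 / 4) \<le> D * \<alpha> * N + ?p * ln (?L / \<epsilon>\<^sup>2)"
      proof -
        have "\<rho> \<le> n * \<rho>" using n \<rho>(1) by simp
        hence "\<rho> + \<alpha> * n * R\<^sup>2 / 4 \<le> n * \<kappa>"
          by (simp add: \<kappa>_def algebra_simps)
        hence "ln (\<rho> + \<alpha> * n * R\<^sup>2 / 4) \<le> ln (n * \<kappa>)"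
          using \<rho>(1) \<alpha> \<kappa> n0 by (subst ln_le_cancel_iff) (auto intro: add_pos_nonneg)
        also have "n * \<kappa> = N * \<kappa> * (1 / \<epsilon>\<^sup>2)" using \<epsilon> by (simp add: N_def)
        also have "ln \<dots> = ln N + ln \<kappa> + ln (1 / \<epsilon>\<^sup>2)"
          using N \<kappa> \<epsilon> by (simp add: ln_mult_pos ln_div)
        finally have "?p / 2 * ln (\<rho> + \<alpha> * n * R\<^sup>2 / 4) \<le> ?p / 2 * (ln N + ln \<kappa> + ln (1 / \<epsilon>\<^sup>2))"
          by (intro mult_left_mono) auto
        moreover have "?p / 2 * ln (1 / \<epsilon>\<^sup>2) \<le> ?p * ln (1 / \<epsilon>\<^sup>2)"
          using \<epsilon> by (intro mult_right_mono) (auto simp: ln_div ln_realpow)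
        moreover have "?p * (ln (4 * R) + ln (1 / \<epsilon>\<^sup>2)) \<le> ?p * ln (?L / \<epsilon>\<^sup>2)"
        proof (intro mult_left_mono)
          have "ln (4 * R) + ln (1 / \<epsilon>\<^sup>2) = ln (4 * R / \<epsilon>\<^sup>2)"
            using 3 \<epsilon> by (simp add: ln_div ln_mult_pos)
          also have "\<dots> \<le> ln (?L / \<epsilon>\<^sup>2)"
            using 3 \<epsilon> L by (subst ln_le_cancel_iff) (auto intro!: divide_right_mono divide_pos_pos)
          finally show "ln (4 * R) + ln (1 / \<epsilon>\<^sup>2) \<le> ln (?L / \<epsilon>\<^sup>2)" .
        qed simp
        moreover have "\<alpha> * N \<le> D * \<alpha> * N" using D \<alpha> N by simp
        ultimately show ?thesis
          using M(2)[OF N(1)] unfolding K_def distrib_left by linarith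
      qed
      have "?G \<subseteq> ?E"
      proof safe
        fix y assume y: "y \<in> responses n" and W: "ennreal \<epsilon> * renyi_integral n X \<alpha> \<mu> ?S \<beta>s y < 1"
        let ?I = "\<integral>\<beta>. scaled_renyi n X \<alpha> \<beta> \<beta>s * ?g y \<beta> \<partial>lborel"
        have "?I \<le> ln (1 / \<epsilon>) + \<alpha> * log_lik n X y \<beta>s - ln (evidence n X \<alpha> \<mu> ?S y (\<xi>s y))"
          by (rule renyi_risk_le_evidence[OF assms(1-3) \<epsilon>(1) W])
        also have "\<dots> \<le> ln (1 / \<epsilon>) + \<alpha> * log_lik n X y \<beta>s - ln (evidence n X \<alpha> \<mu> ?S y (\<lambda>i. X i \<bullet> \<beta>s))"
          using minimizer_evidence_ge[OF \<alpha> S bspec[OF min y], of "\<lambda>i. X i \<bullet> \<beta>s"]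
          by (simp add: evidence_pos[OF \<alpha> S])
        \<comment> \<open>The random term \<open>\<alpha> * log_lik n X y \<beta>s\<close> cancels
          here exactly, which leaves a deterministic bound.\<close>
        also have "\<dots> \<le> ln (1 / \<epsilon>) + n * ?C + (ln (det ?S) / 2 + ?p / 2 * ln (\<rho> + \<alpha> * n * R\<^sup>2 / 4))"
          using evidence_ge[OF \<alpha> S _ n \<rho>, where X = X and y = y and \<beta>' = \<beta>s and \<mu> = \<mu>, OF Xi] by linarith
        also have "\<dots> \<le> ln (1 / \<epsilon>) + n * ?C + (D * \<alpha> * N + ?p * ln (?L / \<epsilon>\<^sup>2))"
          using arith by linarith
        finally have "?I / n \<le> (ln (1 / \<epsilon>) + n * ?C + (D * \<alpha> * N + ?p * ln (?L / \<epsilon>\<^sup>2))) / n"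
          by (rule divide_right_mono) simp
        also have "\<dots> = ?rhs" using n0 by (simp add: N_def field_simps)
        also have "?I / n = (\<integral>\<beta>. (1 - \<alpha>) * (renyi_div n X \<alpha> \<beta> \<beta>s * ?g y \<beta>) \<partial>lborel)"
          by (simp add: mult.assoc[symmetric] scaled_renyi_eq[OF n assms(2)])
        also have "\<dots> = (1 - \<alpha>) * (\<integral>\<beta>. renyi_div n X \<alpha> \<beta> \<beta>s * ?g y \<beta> \<partial>lborel)"
          by (rule integral_mult_right_zero)
        finally show "(1 - \<alpha>) * (\<integral>\<beta>. renyi_div n X \<alpha> \<beta> \<beta>s * ?g y \<beta> \<partial>lborel) \<le> ?rhs" .
      qed
      hence "?P ?G \<le> ?P ?E" by (intro measure_pmf.finite_measure_mono) auto
      \<comment> \<open>In this regime the event already has probability at least 1 - \<epsilon>;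
        subtracting the nonnegative \<open>tail\<close> only weakens the claim.\<close>
      thus ?thesis
        using prob_renyi_integral_ge[OF S \<epsilon>(1), of n X \<beta>s \<alpha> \<mu>] tail by linarith
    qed
    thus "(1 - \<epsilon>) - 1 / ((D - 1)\<^sup>2 * real n * \<epsilon>\<^sup>2) \<le> ?P
        {y. (1 - \<alpha>) * (\<integral>\<beta>. renyi_div n X \<alpha> \<beta> \<beta>s * gauss_density (mu_post n X \<alpha> \<mu> ?S y (\<xi>s y))
             ((1 / \<alpha>) *\<^sub>R Sigma_post n X \<alpha> ?S (\<xi>s y)) \<beta> \<partial>lborel) \<le> ?rhs}"
      by (simp only: post_cov_def)
  qed
qed

end
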